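(* Suppose assumptions A1–A6 (listed in the context) hold. Let $p^*_{ES}$ be the optimal value of the ES-type measure program and $d^*_{ES}$ the optimal value of the ES-type function program (both defined in the context). Then strong duality holds: $p^*_{ES}=d^*_{ES}$.
   Context: Setting. $T>0$ is a finite time horizon, $h\in(0,T]$ a window length, $\epsilon\in[0,1)$ fixed. $X\subset\mathbb{R}^n$ is the state set, $X_0\subseteq X$ the initial set, $p:X\to\mathbb{R}$ a state function, $p_{\min}=\min_{x\in X}p(x)$, $p_{\max}=\max_{x\in X}p(x)$. A stochastic process on $X$ is given as a family of laws $\{\mu_t\}$ with $t\in[0,T]$ (continuous time) or $t\in\{k\Delta t\}_{k=0}^{T/\Delta t}$ (discrete time), and is uniquely described by its generator $\mathcal{L}$ with domain $\mathcal{C}$. Writing $t'=t+\Delta t'$, $\mathcal{L}_{\Delta t}v(t,x)=\lim_{\Delta t'\to\Delta t}\frac{\langle v(t',x),\mu_{t'}\rangle-\langle v(t,x),\mu_t\rangle}{\Delta t'}$; in discrete time $\mathcal{L}=\mathcal{L}_{\Delta t}$ (e.g. for $x[t+\Delta t]=f(t,x[t],\lambda[t])$, $\lambda[t]\sim\zeta$: $\mathcal{L}v(t,x)=(\mathbb{E}_\zeta[v(t+\Delta t,f(t,x,\lambda))]-v(t,x))/\Delta t$, $\mathcal{C}=C([0,T]\times X)$), and in continuous time $\mathcal{L}=\lim_{\Delta t\to0}\mathcal{L}_{\Delta t}$ (e.g. for an Itô SDE $dx=f\,dt+g\,dW$: $\mathcal{L}v=\partial_tv+f\cdot\nabla_xv+\frac12g^T(\nabla^2_{xx}v)g$,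 $\mathcal{C}=C^{1,2}([0,T]\times X)$). The exit time is $\tau_X=\inf\{t: x(t)\in\partial X\}$. Assumptions. A1: $X_0$, $X$, $[0,T]$ are compact. A2: $p$ is continuous. A3: trajectories stop according to the rule $\min(T,\tau_X)$. A4: $\mathcal{C}=\mathrm{dom}(\mathcal{L})\subseteq C([0,T]\times X)$, $1\in\mathcal{C}$, $\mathcal{L}1=0$. A5: $\mathcal{C}$ is closed under multiplication and separates points of $[0,T]\times X$. A6: there is a countable set $\{v_k\}\subset\mathcal{C}$ such that for every $v\in\mathcal{C}$, $(v,\mathcal{L}v)$ lies in the bounded pointwise closure of $\mathrm{span}\{(v_k,\mathcal{L}v_k)\}$. Augmented dynamics. $\hat{\mathcal{L}}$ is the generator of the process $(s,x(t))$ in which $s$ is constant and $x(t)$ follows $\mathcal{L}$; for test functions $v(s,t,x)$, $\hat{\mathcal{L}}v$ is obtained by applying $\mathcal{L}$ in $(t,x)$ with $s$ as a parameter. $\mathcal{C}([h,T]\times[0,T]\times X)$ denotes the domain of $\hat{\mathcal{L}}$ (continuous $v$ with $v(s,\cdot,\cdot)\in\mathcal{C}$ for each $s$ and $\hat{\mathcal L}v$ continuous). Temporal supports: $\Omega_+=\{(s,t)\in[h,T]\times[0,T]: t\in[s-h,s]\}$; $\Omega_-=\{(s,t)\in[h,T]\times[0,T]:t\in[0,s-h]\}$ in continuous time, and $\Omega_-=\{(s,t)\in[h,T]\times[0,T]:t\in[0,s-h-\Delta t]\}$ in discrete time. $\varphi:(s,x)\mapsto(s,s,x)$. $\pi^x$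 is projection onto $x$. $\mathcal{M}_+(K)$ is the set of nonnegative Radon measures on $K$ and $C_+(K)$ the nonnegative continuous functions; $\langle f,\mu\rangle=\int f\,d\mu$; the subscript $\#$ denotes pushforward; $\mathrm{id}_{\mathbb{R}}(q)=q$. ES-type measure program. $p^*_{ES}=\sup\langle\mathrm{id}_{\mathbb{R}},\nu\rangle$ over $\mu_0\in\mathcal{M}_+([h,T]\times X_0)$, $\mu_\tau\in\mathcal{M}_+([h,T]\times X)$ (in variables $(s,x)$), $\mu_+\in\mathcal{M}_+(\Omega_+\times X)$, $\mu_-\in\mathcal{M}_+(\Omega_-\times X)$ (in variables $(s,t,x)$), $\nu,\hat\nu\in\mathcal{M}_+([p_{\min},p_{\max}])$, subject to $\varphi_\#\mu_\tau=\delta_0\otimes\mu_0+\hat{\mathcal{L}}^\dagger(\mu_-+\mu_+)$, $\langle1,\mu_0\rangle=1$, $\langle1,\mu_+\rangle=h$, $\langle1,\nu\rangle=1$, $\epsilon\nu+\hat\nu=p_\#\pi^x_\#(\mu_+/h)$. The first constraint means that for all $v\in\mathcal{C}([h,T]\times[0,T]\times X)$: $\langle v(s,s,x),\mu_\tau\rangle=\langle v(s,0,x),\mu_0\rangle+\langle\hat{\mathcal{L}}v,\mu_-+\mu_+\rangle$. ES-type function program. $d^*_{ES}=\inf\ \gamma+h\xi+\beta$ over $v\in\mathcal{C}([h,T]\times[0,T]\times X)$, $w\in C_+([p_{\min},p_{\max}])$, $\gamma,\xi,\beta\in\mathbb{R}$ subject to: $\gamma\ge v(s,0,x)$ for all $(s,x)\in[h,T]\times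 X_0$; $v(s,s,x)\ge0$ for all $(s,x)\in[h,T]\times X$; $\hat{\mathcal{L}}v(s,t,x)+w(p(x))/h\le\xi$ for all $(s,t,x)\in\Omega_+\times X$; $\hat{\mathcal{L}}v(s,t,x)\le0$ for all $(s,t,x)\in\Omega_-\times X$; $\epsilon w(q)+\beta\ge q$ for all $q\in[p_{\min},p_{\max}]$.
   Formalization: The theorem additionally assumes that the time coordinate v(t,x)=t belongs to the domain C with Lv=1 on [0,T]×X; under A1–A6 alone, with a domain C not containing t, the two optimal values can differ. *)

theory Defs
  imports "HOL-Analysis.Analysis"
begin

section \<open>Generators and their domains\<close>

datatype time_model = Continuous_Time | Discrete_Time real

definition valid_time :: "time_model \<Rightarrow> bool" where
  "valid_time tm \<longleftrightarrow> (case tm of Continuous_Time \<Rightarrow> True | Discrete_Time dt \<Rightarrow> 0 < dt)"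

text \<open>
  A process on \<open>X\<close> enters through its generator: a linear operator \<open>L\<close> on a linear space \<open>C\<close> of
  test functions \<open>v(t,x)\<close>, \<open>(t,x) \<in> [0,T] \<times> X\<close>.  Test functions are represented by total functions
  of which only the values on \<open>[0,T] \<times> X\<close> matter; the first conjunct says that membership in \<open>C\<close>
  and the values of \<open>L v\<close> depend on nothing else.

  The last conjunct asks that the time coordinate be a test function, and gives its generator: the
  defining difference quotient \<open>(\<langle>v(t',x), \<mu>\<^sub>t\<^sub>'\<rangle> - \<langle>v(t,x), \<mu>\<^sub>t\<rangle>) / (t' - t)\<close> evaluated at \<open>v(t,x) = t\<close>: since the laws
  are probability measures it equals \<open>1\<close> for every process, in discrete and in continuous time.
  It bounds the mass of the occupation measures by \<open>T\<close>; for linear operators without any relation to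
  time the two programs below can have different values.
\<close>

definition is_generator ::
    "real \<Rightarrow> 'a::euclidean_space set \<Rightarrow> (real \<times> 'a \<Rightarrow> real) set
      \<Rightarrow> ((real \<times> 'a \<Rightarrow> real) \<Rightarrow> (real \<times> 'a \<Rightarrow> real)) \<Rightarrow> bool" where
  "is_generator T X C L \<longleftrightarrow>
     (\<forall>u v. u \<in> C \<and> (\<forall>z \<in> {0..T} \<times> X. u z = v z)
        \<longrightarrow> v \<in> C \<and> (\<forall>z \<in> {0..T} \<times> X. L u z = L v z)) \<and>
     (\<forall>u \<in> C. \<forall>v \<in> C. (\<lambda>z. u z + v z) \<in> C \<and>
        (\<forall>z \<in> {0..T} \<times> X. L (\<lambda>z. u z + v z) z = L u z + L v z)) \<and>
     (\<forall>c. \<forall>v \<in> C. (\<lambda>z. c * v z) \<in> C \<and>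
        (\<forall>z \<in> {0..T} \<times> X. L (\<lambda>z. c * v z) z = c * L v z)) \<and>
     ((\<lambda>(t, x). t) \<in> C \<and> (\<forall>z \<in> {0..T} \<times> X. L (\<lambda>(t, x). t) z = 1))"

text \<open>
  The bounded pointwise closure (on \<open>K\<close>) of a set \<open>S\<close> of pairs of functions: the smallest superset
  of \<open>S\<close> that is closed under pointwise limits of uniformly bounded sequences.
\<close>

inductive_set bp_closure ::
    "'b set \<Rightarrow> (('b \<Rightarrow> real) \<times> ('b \<Rightarrow> real)) set \<Rightarrow> (('b \<Rightarrow> real) \<times> ('b \<Rightarrow> real)) set"
  for K S where
  base: "fg \<in> S \<Longrightarrow> fg \<in> bp_closure K S"
| limit: "\<lbrakk>\<And>n::nat. (F n, G n) \<in> bp_closure K S;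
           \<And>n z. z \<in> K \<Longrightarrow> \<bar>F n z\<bar> \<le> B \<and> \<bar>G n z\<bar> \<le> B;
           \<And>z. z \<in> K \<Longrightarrow> (\<lambda>n. F n z) \<longlonglongrightarrow> f z;
           \<And>z. z \<in> K \<Longrightarrow> (\<lambda>n. G n z) \<longlonglongrightarrow> g z\<rbrakk> \<Longrightarrow> (f, g) \<in> bp_closure K S"

text \<open>The linear span of \<open>{(v, L v) | v \<in> V}\<close>.\<close>

definition graph_span ::
    "(('b \<Rightarrow> real) \<Rightarrow> ('b \<Rightarrow> real)) \<Rightarrow> ('b \<Rightarrow> real) set \<Rightarrow> (('b \<Rightarrow> real) \<times> ('b \<Rightarrow> real)) set" where
  "graph_span L V =
     {(\<lambda>z. \<Sum>v\<in>F. c v * v z, \<lambda>z. \<Sum>v\<in>F. c v * L v z) | F c. finite F \<and> F \<subseteq> V}"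

text \<open>The generator of the augmented process: \<open>L\<close> acts in \<open>(t,x)\<close>, with \<open>s\<close> as a parameter.\<close>

definition aug_gen ::
    "((real \<times> 'a \<Rightarrow> real) \<Rightarrow> (real \<times> 'a \<Rightarrow> real)) \<Rightarrow>
     (real \<times> real \<times> 'a \<Rightarrow> real) \<Rightarrow> (real \<times> real \<times> 'a \<Rightarrow> real)" where
  "aug_gen L v = (\<lambda>(s, t, x). L (\<lambda>(t', x'). v (s, t', x')) (t, x))"

definition aug_domain ::
    "real \<Rightarrow> real \<Rightarrow> 'a::euclidean_space set \<Rightarrow> (real \<times> 'a \<Rightarrow> real) set
      \<Rightarrow> ((real \<times> 'a \<Rightarrow> real) \<Rightarrow> (real \<times> 'a \<Rightarrow> real)) \<Rightarrow> (real \<times> real \<times> 'a \<Rightarrow> real) set" where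
  "aug_domain h T X C L =
     {v. continuous_on ({h..T} \<times> {0..T} \<times> X) v \<and>
         (\<forall>s \<in> {h..T}. (\<lambda>(t, x). v (s, t, x)) \<in> C) \<and>
         continuous_on ({h..T} \<times> {0..T} \<times> X) (aug_gen L v)}"

section \<open>The measure and function programs\<close>

text \<open>
  Nonnegative Radon measures on \<open>K\<close>.  All sets \<open>K\<close> used below are compact subsets of Euclidean
  spaces, on which the Radon measures are exactly the finite Borel measures.
\<close>

definition radon_on :: "'b::topological_space set \<Rightarrow> 'b measure set" where
  "radon_on K = {\<mu>. sets \<mu> = sets (restrict_space borel K) \<and> finite_measure \<mu>}"

definition p_min :: "'a set \<Rightarrow> ('a \<Rightarrow> real) \<Rightarrow> real" where
  "p_min X p = (INF x\<in>X. p x)"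

definition p_max :: "'a set \<Rightarrow> ('a \<Rightarrow> real) \<Rightarrow> real" where
  "p_max X p = (SUP x\<in>X. p x)"

text \<open>
  \<open>\<Omega>\<^sub>+ \<times> X\<close> and \<open>\<Omega>\<^sub>- \<times> X\<close>, written as sets of triples \<open>(s, t, x)\<close>.
\<close>

definition Omega_plus_X :: "real \<Rightarrow> real \<Rightarrow> 'a set \<Rightarrow> (real \<times> real \<times> 'a) set" where
  "Omega_plus_X h T X = {(s, t, x). s \<in> {h..T} \<and> t \<in> {0..T} \<and> t \<in> {s - h..s} \<and> x \<in> X}"

definition Omega_minus_X :: "time_model \<Rightarrow> real \<Rightarrow> real \<Rightarrow> 'a set \<Rightarrow> (real \<times> real \<times> 'a) set" where
  "Omega_minus_X tm h T X = {(s, t, x). s \<in> {h..T} \<and> t \<in> {0..T} \<and>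
     t \<in> (case tm of Continuous_Time \<Rightarrow> {0..s - h} | Discrete_Time dt \<Rightarrow> {0..s - h - dt}) \<and> x \<in> X}"

text \<open>\<open>p\<^sub># \<pi>\<^sup>x\<^sub># (\<mu> / h)\<close> for a measure \<open>\<mu>\<close> in the variables \<open>(s, t, x)\<close>.\<close>

definition state_law ::
    "real \<Rightarrow> 'a::euclidean_space set \<Rightarrow> ('a \<Rightarrow> real) \<Rightarrow> (real \<times> real \<times> 'a) measure \<Rightarrow> real measure"
  where
  "state_law h X p \<mu> =
     distr (distr (scale_measure (ennreal (1 / h)) \<mu>) (restrict_space borel X) (\<lambda>(s, t, x). x))
       (restrict_space borel {p_min X p..p_max X p}) p"

definition ES_measure_feasible ::
    "time_model \<Rightarrow> real \<Rightarrow> real \<Rightarrow> real \<Rightarrow> 'a::euclidean_space set \<Rightarrow> 'a set \<Rightarrow> ('a \<Rightarrow> real)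
      \<Rightarrow> (real \<times> 'a \<Rightarrow> real) set \<Rightarrow> ((real \<times> 'a \<Rightarrow> real) \<Rightarrow> (real \<times> 'a \<Rightarrow> real))
      \<Rightarrow> (real \<times> 'a) measure \<Rightarrow> (real \<times> 'a) measure
      \<Rightarrow> (real \<times> real \<times> 'a) measure \<Rightarrow> (real \<times> real \<times> 'a) measure
      \<Rightarrow> real measure \<Rightarrow> real measure \<Rightarrow> bool" where
  "ES_measure_feasible tm h T \<epsilon> X X0 p C L \<mu>0 \<mu>\<tau> \<mu>p \<mu>m \<nu> \<nu>' \<longleftrightarrow>
     \<mu>0 \<in> radon_on ({h..T} \<times> X0) \<and>
     \<mu>\<tau> \<in> radon_on ({h..T} \<times> X) \<and>
     \<mu>p \<in> radon_on (Omega_plus_X h T X) \<and>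
     \<mu>m \<in> radon_on (Omega_minus_X tm h T X) \<and>
     \<nu> \<in> radon_on {p_min X p..p_max X p} \<and>
     \<nu>' \<in> radon_on {p_min X p..p_max X p} \<and>
     (\<forall>v \<in> aug_domain h T X C L.
        (\<integral>(s, x). v (s, s, x) \<partial>\<mu>\<tau>) =
          (\<integral>(s, x). v (s, 0, x) \<partial>\<mu>0) + ((\<integral>y. aug_gen L v y \<partial>\<mu>m) + (\<integral>y. aug_gen L v y \<partial>\<mu>p))) \<and>
     measure \<mu>0 (space \<mu>0) = 1 \<and>
     measure \<mu>p (space \<mu>p) = h \<and>
     measure \<nu> (space \<nu>) = 1 \<and>
     (\<forall>A \<in> sets (restrict_space borel {p_min X p..p_max X p}).
        ennreal \<epsilon> * emeasure \<nu> A + emeasure \<nu>' A = emeasure (state_law h X p \<mu>p) A)"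

definition p_ES ::
    "time_model \<Rightarrow> real \<Rightarrow> real \<Rightarrow> real \<Rightarrow> 'a::euclidean_space set \<Rightarrow> 'a set \<Rightarrow> ('a \<Rightarrow> real)
      \<Rightarrow> (real \<times> 'a \<Rightarrow> real) set \<Rightarrow> ((real \<times> 'a \<Rightarrow> real) \<Rightarrow> (real \<times> 'a \<Rightarrow> real)) \<Rightarrow> ereal" where
  "p_ES tm h T \<epsilon> X X0 p C L =
     Sup {ereal (\<integral>q. q \<partial>\<nu>) | \<mu>0 \<mu>\<tau> \<mu>p \<mu>m \<nu> \<nu>'.
            ES_measure_feasible tm h T \<epsilon> X X0 p C L \<mu>0 \<mu>\<tau> \<mu>p \<mu>m \<nu> \<nu>'}"

definition ES_function_feasible ::
    "time_model \<Rightarrow> real \<Rightarrow> real \<Rightarrow> real \<Rightarrow> 'a::euclidean_space set \<Rightarrow> 'a set \<Rightarrow> ('a \<Rightarrow> real)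
      \<Rightarrow> (real \<times> 'a \<Rightarrow> real) set \<Rightarrow> ((real \<times> 'a \<Rightarrow> real) \<Rightarrow> (real \<times> 'a \<Rightarrow> real))
      \<Rightarrow> (real \<times> real \<times> 'a \<Rightarrow> real) \<Rightarrow> (real \<Rightarrow> real) \<Rightarrow> real \<Rightarrow> real \<Rightarrow> real \<Rightarrow> bool" where
  "ES_function_feasible tm h T \<epsilon> X X0 p C L v w \<gamma> \<xi> \<beta> \<longleftrightarrow>
     v \<in> aug_domain h T X C L \<and>
     continuous_on {p_min X p..p_max X p} w \<and>
     (\<forall>q \<in> {p_min X p..p_max X p}. 0 \<le> w q) \<and>
     (\<forall>s \<in> {h..T}. \<forall>x \<in> X0. \<gamma> \<ge> v (s, 0, x)) \<and>
     (\<forall>s \<in> {h..T}. \<forall>x \<in> X. v (s, s, x) \<ge> 0) \<and>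
     (\<forall>(s, t, x) \<in> Omega_plus_X h T X. aug_gen L v (s, t, x) + w (p x) / h \<le> \<xi>) \<and>
     (\<forall>(s, t, x) \<in> Omega_minus_X tm h T X. aug_gen L v (s, t, x) \<le> 0) \<and>
     (\<forall>q \<in> {p_min X p..p_max X p}. \<epsilon> * w q + \<beta> \<ge> q)"

definition d_ES ::
    "time_model \<Rightarrow> real \<Rightarrow> real \<Rightarrow> real \<Rightarrow> 'a::euclidean_space set \<Rightarrow> 'a set \<Rightarrow> ('a \<Rightarrow> real)
      \<Rightarrow> (real \<times> 'a \<Rightarrow> real) set \<Rightarrow> ((real \<times> 'a \<Rightarrow> real) \<Rightarrow> (real \<times> 'a \<Rightarrow> real)) \<Rightarrow> ereal" where
  "d_ES tm h T \<epsilon> X X0 p C L =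
     Inf {ereal (\<gamma> + h * \<xi> + \<beta>) | v w \<gamma> \<xi> \<beta>.
            ES_function_feasible tm h T \<epsilon> X X0 p C L v w \<gamma> \<xi> \<beta>}"

end

theory Submission
  imports Defs "HOL-Probability.Discrete_Topology"
begin

text \<open>
  The two programs are a dual pair of linear programs, and there is no gap because the constraints of
  the measure program bound the masses of all six measures.  Testing the Liouville equation with the
  constants gives \<open>\<mu>\<tau>\<close> the mass of \<open>\<mu>0\<close>, testing it with the time coordinate bounds the total mass of
  the occupation measures by \<open>T\<close>, and the normalizations together with the law constraint bound the rest.
  On the dual side this boundedness says that some combination of the constraints is uniformly positive
  (\<open>rows_majorize\<close>), which is a Slater condition for the function program.

  The measures are obtained from the Hahn-Banach theorem in the form of \<open>conic_duality\<close>.  Six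
  measures act together as one functional \<open>\<Lambda>\<close> on six-tuples of functions, and the constraints prescribe
  its value \<open>\<gamma> + h \<xi> + \<beta>\<close> on every tuple \<open>row v w \<gamma> \<xi> \<beta>\<close>.  The best upper bound that these equations
  imply for \<open>\<Lambda> g\<close> is sublinear in \<open>g\<close>, and at the objective it is the value of the function program.  A
  linear functional below it which agrees with it at the objective is positive, satisfies all the
  constraints, and attains the dual value.

  Positive functionals become measures through \<open>Riesz_representation\<close>.  Here it is convenient that \<open>\<Lambda>\<close>
  is defined on all bounded functions and not only on the continuous ones: its values on indicator
  functions form a finitely additive content, which Caratheodory's construction turns into a Borel
  measure.  The integrals of continuous functions are not changed by this, because the measure is at
  most the content on open sets and at least the content on closed sets.  The law constraint is an
  identity of measures, while the functional sees only integrals of continuous functions;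
  \<open>measure_combination_eqI\<close> closes this gap.
\<close>

section \<open>The Hahn-Banach theorem and conic duality\<close>

definition sublinear :: "('v::real_vector \<Rightarrow> real) \<Rightarrow> bool" where
  "sublinear q \<longleftrightarrow> (\<forall>x y. q (x + y) \<le> q x + q y) \<and> (\<forall>c\<ge>0. \<forall>x. q (c *\<^sub>R x) = c * q x)"

lemma sublinearD:
  assumes "sublinear q"
  shows "q (x + y) \<le> q x + q y" and "0 \<le> c \<Longrightarrow> q (c *\<^sub>R x) = c * q x"
    and "q 0 = 0" and "- q (- x) \<le> q x"
proof -
  show add: "q (x + y) \<le> q x + q y" for x y using assms by (simp add: sublinear_def)
  show scale: "0 \<le> c \<Longrightarrow> q (c *\<^sub>R x) = c * q x" for c x using assms by (simp add: sublinear_def)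
  show zero: "q 0 = 0" using scale[of 0 0] by simp
  show "- q (- x) \<le> q x" using add[of x "- x"] zero by simp
qed

lemma sublinearI:
  assumes add: "\<And>x y. q (x + y) \<le> q x + q y"
    and scale: "\<And>c x. 0 < c \<Longrightarrow> q (c *\<^sub>R x) \<le> c * q x"
    and zero: "q 0 = 0"
  shows "sublinear q"
  unfolding sublinear_def
proof (intro conjI allI impI)
  fix c :: real and x assume "0 \<le> c"
  show "q (c *\<^sub>R x) = c * q x"
  proof (cases "c = 0")
    case False
    with \<open>0 \<le> c\<close> have c: "0 < c" by simp
    have "q x \<le> inverse c * q (c *\<^sub>R x)"
      using scale[of "inverse c" "c *\<^sub>R x"] c by simp
    with c have "c * q x \<le> q (c *\<^sub>R x)" by (simp add: field_simps)
    with scale[OF c, of x] show ?thesis by simp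
  qed (simp add: zero)
qed (rule add)

text \<open>
  The infimum over a chain is finite because every sublinear \<open>p \<le> q\<close> satisfies \<open>- q (- x) \<le> - p (- x) \<le> p x\<close>.
  It is subadditive because two members of the chain, one used at \<open>x\<close> and the other at \<open>y\<close>, can both be
  replaced by the smaller of the two.
\<close>

lemma sublinear_INF_chain:
  assumes "D \<noteq> {}" and sub: "\<And>p. p \<in> D \<Longrightarrow> sublinear p"
    and le: "\<And>p x. p \<in> D \<Longrightarrow> p x \<le> q x"
    and chain: "\<And>p r. p \<in> D \<Longrightarrow> r \<in> D \<Longrightarrow> p \<le> r \<or> r \<le> p"
  shows "sublinear (\<lambda>x. INF p\<in>D. p x)" and "\<And>p x. p \<in> D \<Longrightarrow> (INF p\<in>D. p x) \<le> p x"
proof -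
  have "- q (- x) \<le> p x" if "p \<in> D" for p x
    using sublinearD(4)[OF sub[OF that], of x] le[OF that, of "- x"] by simp
  then have bdd: "bdd_below ((\<lambda>p. p x) ` D)" for x
    by (rule bdd_belowI2)
  show low: "(INF p\<in>D. p x) \<le> p x" if "p \<in> D" for p x
    using bdd that by (rule cINF_lower)
  show "sublinear (\<lambda>x. INF p\<in>D. p x)"
  proof (rule sublinearI)
    fix x y
    have "(INF p\<in>D. p (x + y)) - p x \<le> r y" if "p \<in> D" "r \<in> D" for p r
    proof -
      obtain u where "u \<in> D" "u \<le> p" "u \<le> r" using chain \<open>p \<in> D\<close> \<open>r \<in> D\<close> by blast
      then show ?thesis
        using low[of u "x + y"] sublinearD(1)[OF sub, of u x y] le_funD[of u p x] le_funD[of u r y]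
        by linarith
    qed
    then have "(INF p\<in>D. p (x + y)) - p x \<le> (INF p\<in>D. p y)" if "p \<in> D" for p
      using that by (intro cINF_greatest) (auto simp: assms(1))
    then have "(INF p\<in>D. p (x + y)) - (INF p\<in>D. p y) \<le> (INF p\<in>D. p x)"
      by (intro cINF_greatest) (auto simp: assms(1) algebra_simps)
    then show "(INF p\<in>D. p (x + y)) \<le> (INF p\<in>D. p x) + (INF p\<in>D. p y)" by simp
  next
    fix c :: real and x assume c: "0 < c"
    have "(INF p\<in>D. p (c *\<^sub>R x)) / c \<le> (INF p\<in>D. p x)"
    proof (rule cINF_greatest)
      fix p assume p: "p \<in> D"
      show "(INF p\<in>D. p (c *\<^sub>R x)) / c \<le> p x"
        using low[OF p, of "c *\<^sub>R x"] sublinearD(2)[OF sub[OF p], of c x] c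
        by (simp add: field_simps)
    qed (fact assms(1))
    then show "(INF p\<in>D. p (c *\<^sub>R x)) \<le> c * (INF p\<in>D. p x)" using c by (simp add: field_simps)
  next
    have "(INF p\<in>D. p 0) = (INF p\<in>D. 0)" using sublinearD(3)[OF sub] by (intro INF_cong) auto
    then show "(INF p\<in>D. p 0) = 0" using assms(1) by simp
  qed
qed

lemma minimal_sublinear_below:
  assumes q: "sublinear q"
  obtains p where "sublinear p" "p \<le> q" "\<And>r. sublinear r \<Longrightarrow> r \<le> p \<Longrightarrow> r = p"
proof -
  define S where "S = {p. sublinear p \<and> p \<le> q}"
  have "\<exists>m\<in>S. \<forall>r\<in>S. r \<le> m \<longrightarrow> r = m"
  proof (rule predicate_Zorn)
    show "partial_order_on S (relation_of (\<lambda>x y. y \<le> x) S)"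
      by (rule partial_order_on_relation_ofI) auto
  next
    fix D assume D: "D \<in> Chains (relation_of (\<lambda>x y. y \<le> x) S)"
    then have DS: "D \<subseteq> S" by (auto simp: Chains_def relation_of_def)
    have chain: "\<And>p r. p \<in> D \<Longrightarrow> r \<in> D \<Longrightarrow> p \<le> r \<or> r \<le> p"
      using D by (auto simp: Chains_def relation_of_def)
    show "\<exists>u\<in>S. \<forall>a\<in>D. u \<le> a"
    proof (cases "D = {}")
      case True
      then show ?thesis using q by (auto simp: S_def)
    next
      case False
      have le: "\<And>p x. p \<in> D \<Longrightarrow> p x \<le> q x" and sub: "\<And>p. p \<in> D \<Longrightarrow> sublinear p"
        using DS by (auto simp: S_def le_fun_def)
      have "sublinear (\<lambda>x. INF p\<in>D. p x)"
        by (rule sublinear_INF_chain(1)[of D q]) (fact False, fact sub, fact le, fact chain)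
      moreover have low: "(\<lambda>x. INF p\<in>D. p x) \<le> p" if "p \<in> D" for p
      proof (rule le_funI)
        show "(INF p\<in>D. p x) \<le> p x" for x
          by (rule sublinear_INF_chain(2)[where D=D and q=q and p=p and x=x])
            (fact False, fact sub, fact le, fact chain, fact that)
      qed
      moreover obtain p where "p \<in> D" using False by blast
      ultimately show ?thesis
        using DS by (intro bexI[of _ "\<lambda>x. INF p\<in>D. p x"]) (auto simp: S_def intro: order_trans[of _ p q])
    qed
  qed
  then show ?thesis using that unfolding S_def by (auto intro: order_trans)
qed

text \<open>
  The witness is \<open>r x = inf {t \<ge> 0} (q (x + t e) - t q e)\<close>: moving the argument far in the direction \<open>e\<close> and
  subtracting what \<open>q\<close> charges for the move gives a smaller sublinear functional that is already linear
  in the direction \<open>e\<close>.  It serves twice below: a minimal \<open>q\<close> must agree with \<open>r\<close>, and a functional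
  below \<open>r\<close> must touch \<open>q\<close> at \<open>e\<close>.
\<close>

lemma tilted_sublinear:
  assumes q: "sublinear q"
  obtains r where "sublinear r" "r \<le> q" "\<And>x. r x \<le> q (x + e) - q e"
proof -
  define g where "g x t = q (x + t *\<^sub>R e) - t * q e" for x t
  define r where "r x = (INF t\<in>{0..}. g x t)" for x
  have "- q (- x) \<le> g x t" if "0 \<le> t" for x t
    using sublinearD(1)[OF q, of "x + t *\<^sub>R e" "- x"] sublinearD(2)[OF q that, of e]
    by (simp add: g_def)
  then have "bdd_below (g x ` {0..})" for x
    by (intro bdd_belowI2) simp
  then have low: "r x \<le> g x t" if "0 \<le> t" for x t
    unfolding r_def using that by (intro cINF_lower) auto
  have "sublinear r"
  proof (rule sublinearI)
    fix x y
    have *: "r (x + y) \<le> g x s + g y t" if "0 \<le> s" "0 \<le> t" for s t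
    proof -
      have "q (x + y + (s + t) *\<^sub>R e) \<le> q (x + s *\<^sub>R e) + q (y + t *\<^sub>R e)"
        using sublinearD(1)[OF q, of "x + s *\<^sub>R e" "y + t *\<^sub>R e"] by (simp add: algebra_simps)
      then show ?thesis
        using low[of "s + t" "x + y"] that by (simp add: g_def algebra_simps)
    qed
    have "r (x + y) - g x s \<le> r y" if "0 \<le> s" for s
      unfolding r_def[of y] using *[OF that] by (intro cINF_greatest) (auto simp: algebra_simps)
    then have "r (x + y) - r y \<le> r x"
      unfolding r_def[of x] by (intro cINF_greatest) (auto simp: algebra_simps)
    then show "r (x + y) \<le> r x + r y" by simp
  next
    fix c :: real and x assume c: "0 < c"
    have "r (c *\<^sub>R x) / c \<le> r x"
      unfolding r_def[of x]
    proof (rule cINF_greatest)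
      fix t :: real assume t: "t \<in> {0..}"
      have "g (c *\<^sub>R x) (c * t) = c * g x t"
        using sublinearD(2)[OF q, of c "x + t *\<^sub>R e"] c by (simp add: g_def algebra_simps)
      with low[of "c * t" "c *\<^sub>R x"] c t show "r (c *\<^sub>R x) / c \<le> g x t"
        by (simp add: field_simps)
    qed simp
    then show "r (c *\<^sub>R x) \<le> c * r x" using c by (simp add: field_simps)
  next
    have "g 0 t = 0" if "0 \<le> t" for t
      using sublinearD(2)[OF q that, of e] by (simp add: g_def)
    then have "g 0 ` {0..} = {0}" by force
    then show "r 0 = 0" by (simp add: r_def)
  qed
  moreover have "r \<le> q" using low[of 0] by (auto simp: le_fun_def g_def)
  moreover have "r x \<le> q (x + e) - q e" for x using low[of 1 x] by (simp add: g_def)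
  ultimately show ?thesis by (rule that)
qed

text \<open>
  Minimality forces the tilted functional to be \<open>q\<close> itself, and the tilting inequality then reads
  \<open>q x + q e \<le> q (x + e)\<close>, the half of additivity that sublinearity does not give.
\<close>

lemma minimal_sublinear_linear:
  assumes q: "sublinear q" and minimal: "\<And>r. sublinear r \<Longrightarrow> r \<le> q \<Longrightarrow> r = q"
  shows "linear q"
proof -
  have add: "q (x + y) = q x + q y" for x y
  proof -
    obtain r where "sublinear r" "r \<le> q" "\<And>x. r x \<le> q (x + y) - q y"
      using tilted_sublinear[OF q] by blast
    then have "q x + q y \<le> q (x + y)" using minimal[of r] by (simp add: le_diff_eq)
    then show ?thesis using sublinearD(1)[OF q, of x y] by simp
  qed
  have neg: "q (- x) = - q x" for x
    using add[of x "- x"] sublinearD(3)[OF q] by simp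
  show ?thesis
  proof (rule linearI[OF add])
    show "q (c *\<^sub>R x) = c *\<^sub>R q x" for c x
    proof (cases "0 \<le> c")
      case False
      then show ?thesis
        using sublinearD(2)[OF q, of "- c" x] neg[of "c *\<^sub>R x"] by simp
    qed (simp add: sublinearD(2)[OF q])
  qed
qed

text \<open>
  Start from the tilt \<open>r\<close> of \<open>q\<close> and pass to a minimal sublinear functional below it, which is linear.
  Since \<open>r (- e) \<le> - q e\<close>, any linear functional below \<open>r\<close> has value at least \<open>q e\<close> at \<open>e\<close>.
\<close>

theorem Hahn_Banach:
  assumes q: "sublinear q"
  obtains \<Lambda> where "linear \<Lambda>" "\<And>x. \<Lambda> x \<le> q x" "\<Lambda> e = q e"
proof -
  obtain r where r: "sublinear r" "r \<le> q" "\<And>x. r x \<le> q (x + e) - q e"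
    using tilted_sublinear[OF q] by blast
  obtain \<Lambda> where L: "sublinear \<Lambda>" "\<Lambda> \<le> r" "\<And>r. sublinear r \<Longrightarrow> r \<le> \<Lambda> \<Longrightarrow> r = \<Lambda>"
    using minimal_sublinear_below[OF r(1)] by blast
  have lin: "linear \<Lambda>" using minimal_sublinear_linear[OF L(1,3)] by blast
  have le: "\<Lambda> x \<le> q x" for x using L(2) r(2) by (meson le_funD order_trans)
  have "\<Lambda> (- e) \<le> - q e"
    using L(2) r(3)[of "- e"] sublinearD(3)[OF q] by (metis add.left_inverse diff_0 le_funD order_trans)
  then have "\<Lambda> e = q e" using le[of e] linear_neg[OF lin, of e] by simp
  with lin le show ?thesis by (rule that)
qed

text \<open>
  Each \<open>(f, b) \<in> P\<close> is a linear equation \<open>\<Lambda> f = b\<close> for an unknown positive functional \<open>\<Lambda>\<close>, and \<open>b\<close> bounds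
  \<open>\<Lambda> e\<close> from above whenever \<open>f\<close> dominates \<open>e\<close>; with \<open>d\<close> the infimum of these bounds, the statement
  says that some \<open>\<Lambda>\<close> attains it.  The functional \<open>q g = inf {b | (f, b) \<in> P, f - g \<in> N}\<close>, the best bound for \<open>\<Lambda> g\<close> that
  the equations imply, is sublinear, and a linear functional below \<open>q\<close> is automatically positive and
  satisfies all equations.
\<close>

theorem conic_duality:
  fixes P :: "('v::real_vector \<times> real) set" and N :: "'v set"
  assumes P: "subspace P"
    and N: "0 \<in> N" "\<And>x y. x \<in> N \<Longrightarrow> y \<in> N \<Longrightarrow> x + y \<in> N" "\<And>c x. 0 \<le> c \<Longrightarrow> x \<in> N \<Longrightarrow> c *\<^sub>R x \<in> N"
    and majorant: "\<And>g. \<exists>(f, b)\<in>P. f - g \<in> N"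
    and bound: "\<And>f b. (f, b) \<in> P \<Longrightarrow> f - e \<in> N \<Longrightarrow> d \<le> b"
  obtains \<Lambda> where "linear \<Lambda>" "\<And>x. x \<in> N \<Longrightarrow> 0 \<le> \<Lambda> x" "\<And>f b. (f, b) \<in> P \<Longrightarrow> \<Lambda> f = b" "d \<le> \<Lambda> e"
proof -
  have P0: "(0, 0) \<in> P" using subspace_0[OF P] by (simp add: zero_prod_def)
  have Padd: "(f + f', b + b') \<in> P" if "(f, b) \<in> P" "(f', b') \<in> P" for f f' b b'
    using subspace_add[OF P that] by simp
  have Pscale: "(c *\<^sub>R f, c * b) \<in> P" if "(f, b) \<in> P" for f b c
    using subspace_scale[OF P that, of c] by simp
  define B where "B g = {b. \<exists>f. (f, b) \<in> P \<and> f - g \<in> N}" for g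
  define q where "q g = Inf (B g)" for g
  have ne: "B g \<noteq> {}" for g using majorant[of g] by (auto simp: B_def)
  have B_add: "b + b' \<in> B (g + g')" if b: "b \<in> B g" "b' \<in> B g'" for b b' g g'
  proof -
    obtain f f' where "(f, b) \<in> P" "f - g \<in> N" "(f', b') \<in> P" "f' - g' \<in> N"
      using b by (auto simp: B_def)
    then show ?thesis
      using Padd[of f b f' b'] N(2)[of "f - g" "f' - g'"] by (auto simp: B_def algebra_simps)
  qed
  have B_scale: "c * b \<in> B (c *\<^sub>R g)" if b: "b \<in> B g" "0 \<le> c" for b c g
  proof -
    obtain f where "(f, b) \<in> P" "f - g \<in> N" using b by (auto simp: B_def)
    then show ?thesis
      using Pscale[of f b c] N(3)[OF b(2), of "f - g"] by (auto simp: B_def algebra_simps)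
  qed
  \<comment> \<open>A negative bound for \<open>\<Lambda> 0\<close> could be added to any bound for \<open>\<Lambda> e\<close> arbitrarily often, contradicting \<open>d\<close>.\<close>
  have B0: "0 \<le> b" if b: "b \<in> B 0" for b
  proof (rule ccontr)
    assume "\<not> 0 \<le> b"
    obtain a where a: "a \<in> B e" using ne by blast
    have da: "d \<le> b'" if "b' \<in> B e" for b' using that bound by (auto simp: B_def)
    define t where "t = (a - d + 1) / (- b)"
    have t: "0 \<le> t" "t * b = - (a - d + 1)"
      using \<open>\<not> 0 \<le> b\<close> da[OF a] by (auto simp: t_def field_simps)
    have "a + t * b \<in> B e" using B_add[OF a B_scale[OF b t(1)]] by simp
    from da[OF this] t(2) show False by simp
  qed
  have "bdd_below (B g)" for g
  proof -
    obtain a where a: "a \<in> B (- g)" using ne by blast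
    have "- a \<le> b" if "b \<in> B g" for b using B0[of "a + b"] B_add[OF a that] by simp
    then show ?thesis by (rule bdd_belowI)
  qed
  then have low: "q g \<le> b" if "b \<in> B g" for g b unfolding q_def using that by (intro cInf_lower)
  have "0 \<in> B 0" using P0 N(1) by (auto simp: B_def)
  have "sublinear q"
  proof (rule sublinearI)
    fix x y
    have "q (x + y) - b \<le> b'" if "b \<in> B x" "b' \<in> B y" for b b'
      using low[OF B_add[OF that]] by simp
    then have "q (x + y) - b \<le> q y" if "b \<in> B x" for b
      unfolding q_def[of y] using that by (intro cInf_greatest[OF ne]) auto
    then have "q (x + y) - q y \<le> q x"
      unfolding q_def[of x] by (intro cInf_greatest[OF ne]) (auto simp: algebra_simps)
    then show "q (x + y) \<le> q x + q y" by simp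
  next
    fix c :: real and x assume c: "0 < c"
    have "q (c *\<^sub>R x) / c \<le> q x"
      unfolding q_def[of x]
      using low[OF B_scale, of _ x c] c by (intro cInf_greatest[OF ne]) (simp add: field_simps)
    then show "q (c *\<^sub>R x) \<le> c * q x" using c by (simp add: field_simps)
  next
    have "0 \<le> q 0" unfolding q_def using B0 by (intro cInf_greatest[OF ne])
    with low[OF \<open>0 \<in> B 0\<close>] show "q 0 = 0" by simp
  qed
  then obtain \<Lambda> where \<Lambda>: "linear \<Lambda>" "\<And>x. \<Lambda> x \<le> q x" "\<Lambda> e = q e" using Hahn_Banach by blast
  show ?thesis
  proof
    show "linear \<Lambda>" by (fact \<Lambda>)
    show "0 \<le> \<Lambda> x" if "x \<in> N" for x
    proof -
      have "0 \<in> B (- x)" using that P0 by (auto simp: B_def)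
      from low[OF this] \<Lambda>(2)[of "- x"] linear_neg[OF \<Lambda>(1), of x] show ?thesis by simp
    qed
    have row: "\<Lambda> f \<le> b" if "(f, b) \<in> P" for f b
      using low[of b f] that N(1) \<Lambda>(2)[of f] by (force simp: B_def)
    show "\<Lambda> f = b" if "(f, b) \<in> P" for f b
      using row[OF that] row[of "- f" "- b"] Pscale[OF that, of "- 1"] linear_neg[OF \<Lambda>(1), of f]
      by simp
    show "d \<le> \<Lambda> e"
      unfolding \<Lambda>(3) q_def using bound by (intro cInf_greatest[OF ne]) (auto simp: B_def)
  qed
qed

section \<open>From contents to measures\<close>

text \<open>
  A finitely additive set function on all subsets.  It is only a content, but its values on compact sets
  determine a measure: \<open>inner_content\<close> approximates open sets by compact subsets, and \<open>outer_content\<close>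
  is the outer measure that open supersets induce.
\<close>

locale content =
  fixes m :: "'e::metric_space set \<Rightarrow> real"
  assumes nonneg: "0 \<le> m A"
    and additive: "A \<inter> B = {} \<Longrightarrow> m (A \<union> B) = m A + m B"
begin

lemma content_empty: "m {} = 0"
  using additive[of "{}" "{}"] by simp

lemma content_mono: "A \<subseteq> B \<Longrightarrow> m A \<le> m B"
  using additive[of A "B - A"] nonneg[of "B - A"] by (simp add: Un_absorb1)

lemma content_subadditive: "m (A \<union> B) \<le> m A + m B"
  using additive[of A "B - A"] content_mono[of "B - A" B] by simp

lemma content_finite_subadditive: "finite I \<Longrightarrow> m (\<Union>i\<in>I. A i) \<le> (\<Sum>i\<in>I. m (A i))"
proof (induction rule: finite_induct)
  case (insert i I)
  then show ?case using content_subadditive[of "A i" "\<Union>i\<in>I. A i"] by simp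
qed (simp add: content_empty)

definition inner_content :: "'e set \<Rightarrow> ennreal" where
  "inner_content U = (SUP C\<in>{C. compact C \<and> C \<subseteq> U}. ennreal (m C))"

definition outer_content :: "'e set \<Rightarrow> ennreal" where
  "outer_content A = (INF U\<in>{U. open U \<and> A \<subseteq> U}. inner_content U)"

lemma inner_content_upper: "compact C \<Longrightarrow> C \<subseteq> U \<Longrightarrow> ennreal (m C) \<le> inner_content U"
  unfolding inner_content_def by (intro SUP_upper) auto

lemma inner_content_le: "inner_content U \<le> ennreal (m U)"
  unfolding inner_content_def by (intro SUP_least) (auto intro!: ennreal_leI content_mono)

lemma inner_content_mono: "U \<subseteq> V \<Longrightarrow> inner_content U \<le> inner_content V"
  unfolding inner_content_def by (intro SUP_subset_mono) auto

lemma outer_content_open: "open U \<Longrightarrow> outer_content U = inner_content U"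
  unfolding outer_content_def by (intro antisym INF_lower INF_greatest) (auto intro: inner_content_mono)

lemma outer_content_le_inner: "open U \<Longrightarrow> A \<subseteq> U \<Longrightarrow> outer_content A \<le> inner_content U"
  unfolding outer_content_def by (intro INF_lower) auto

lemma outer_content_mono: "A \<subseteq> B \<Longrightarrow> outer_content A \<le> outer_content B"
  unfolding outer_content_def by (intro INF_superset_mono) auto

lemma outer_content_greatest:
  "(\<And>U. open U \<Longrightarrow> A \<subseteq> U \<Longrightarrow> x \<le> inner_content U) \<Longrightarrow> x \<le> outer_content A"
  unfolding outer_content_def by (rule INF_greatest) simp

lemma outer_content_close: "outer_content A < x \<Longrightarrow> \<exists>U. open U \<and> A \<subseteq> U \<and> inner_content U < x"
  by (auto simp: outer_content_def INF_less_iff)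

text \<open>
  Compactness turns finite into countable subadditivity: a compact \<open>C\<close> inside the union is covered by
  finitely many \<open>U i\<close>, and a Lebesgue number \<open>e\<close> of this cover splits \<open>C\<close> into compact pieces, the points
  whose \<open>e\<close>-ball lies in \<open>U i\<close>.
\<close>

lemma inner_content_countably_subadditive:
  fixes U :: "nat \<Rightarrow> 'e set"
  assumes U: "\<And>i. open (U i)"
  shows "inner_content (\<Union>i. U i) \<le> (\<Sum>i. inner_content (U i))"
  unfolding inner_content_def[of "\<Union>i. U i"]
proof (rule SUP_least)
  fix C assume "C \<in> {C. compact C \<and> C \<subseteq> (\<Union>i. U i)}"
  then have C: "compact C" "C \<subseteq> (\<Union>i. U i)" by auto
  obtain I where I: "finite I" "C \<subseteq> (\<Union>i\<in>I. U i)"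
    using compactE_image[OF C(1), of UNIV U] U C(2) by auto
  have "\<And>G. G \<in> U ` I \<Longrightarrow> open G" using U by auto
  with Heine_Borel_lemma[OF C(1) I(2)]
  obtain e where e: "0 < e" "\<And>x. x \<in> C \<Longrightarrow> \<exists>G\<in>U ` I. ball x e \<subseteq> G" by blast
  define D where "D i = C - (\<Union>y\<in>- U i. ball y e)" for i
  have D: "compact (D i)" for i
    unfolding D_def by (intro compact_diff C(1) open_UN) auto
  have DU: "D i \<subseteq> U i" for i
    using e(1) by (auto simp: D_def)
  have CD: "C \<subseteq> (\<Union>i\<in>I. D i)"
    using e(2) by (fastforce simp: D_def dist_commute)
  have "m C \<le> (\<Sum>i\<in>I. m (D i))"
    using content_mono[OF CD] content_finite_subadditive[OF I(1), of D] by simp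
  then have "ennreal (m C) \<le> (\<Sum>i\<in>I. ennreal (m (D i)))"
    by (simp add: nonneg sum_ennreal ennreal_leI)
  also have "\<dots> \<le> (\<Sum>i\<in>I. inner_content (U i))"
    by (intro sum_mono inner_content_upper D DU)
  also have "\<dots> \<le> (\<Sum>i. inner_content (U i))"
    by (intro sum_le_suminf I(1)) auto
  finally show "ennreal (m C) \<le> (\<Sum>i. inner_content (U i))" .
qed

lemma outer_content_countably_subadditive:
  fixes A :: "nat \<Rightarrow> 'e set"
  shows "outer_content (\<Union>i. A i) \<le> (\<Sum>i. outer_content (A i))"
proof (rule ennreal_le_epsilon)
  fix e :: real assume "0 < e" "(\<Sum>i. outer_content (A i)) < top"
  then have "outer_content (A n) < outer_content (A n) + e * (1/2)^Suc n" for n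
    by (auto simp add: less_top dest!: ennreal_suminf_lessD)
  from outer_content_close[OF this]
  have "\<exists>U. open U \<and> A n \<subseteq> U \<and> inner_content U \<le> outer_content (A n) + e * (1/2)^Suc n" for n
    using less_imp_le by fast
  then have "\<forall>n. \<exists>U. open U \<and> A n \<subseteq> U \<and> inner_content U \<le> outer_content (A n) + e * (1/2)^Suc n" by blast
  from choice[OF this] obtain U where U: "\<And>n. open (U n)" "\<And>n. A n \<subseteq> U n"
      "\<And>n. inner_content (U n) \<le> outer_content (A n) + e * (1/2)^Suc n"
    by blast
  have "outer_content (\<Union>i. A i) \<le> inner_content (\<Union>i. U i)"
    using U(1,2) by (intro outer_content_le_inner open_UN) auto
  also have "\<dots> \<le> (\<Sum>i. inner_content (U i))"
    by (intro inner_content_countably_subadditive U)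
  also have "\<dots> \<le> (\<Sum>n. outer_content (A n) + e * (1/2) ^ Suc n)"
    by (intro suminf_le U(3) allI) auto
  also have "\<dots> = (\<Sum>n. outer_content (A n)) + (\<Sum>n. ennreal e * ennreal ((1/2) ^ Suc n))"
    using \<open>0 < e\<close> by (subst suminf_add[symmetric])
       (auto simp del: ennreal_suminf_cmult simp add: ennreal_mult[symmetric])
  also have "\<dots> = (\<Sum>n. outer_content (A n)) + e"
    unfolding ennreal_suminf_cmult
    by (subst suminf_ennreal_eq[OF zero_le_power power_half_series]) auto
  finally show "outer_content (\<Union>i. A i) \<le> (\<Sum>n. outer_content (A n)) + e" .
qed

lemma outer_measure_space_outer_content: "outer_measure_space (Pow UNIV) outer_content"
proof -
  have "outer_content {} = 0"
    using inner_content_le[of "{}"] by (simp add: outer_content_open content_empty)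
  then show ?thesis
    by (auto simp: outer_measure_space_def positive_def increasing_def countably_subadditive_def
        intro: outer_content_mono outer_content_countably_subadditive)
qed

text \<open>
  Choose a compact \<open>C \<subseteq> V \<inter> U\<close> first, and then a compact \<open>D\<close> in the open set \<open>U - C\<close>, which contains
  \<open>U - V\<close>; the two are disjoint, so their contents add up.
\<close>

lemma inner_content_split: "open V \<Longrightarrow> open U \<Longrightarrow> inner_content (V \<inter> U) + outer_content (U - V) \<le> inner_content U"
proof -
  assume V: "open V" and U: "open U"
  have "inner_content (V \<inter> U) + outer_content (U - V) = (SUP C\<in>{C. compact C \<and> C \<subseteq> V \<inter> U}. ennreal (m C) + outer_content (U - V))"
    unfolding inner_content_def[of "V \<inter> U"] by (intro ennreal_SUP_add_left[symmetric]) auto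
  also have "\<dots> \<le> inner_content U"
  proof (rule SUP_least)
    fix C assume "C \<in> {C. compact C \<and> C \<subseteq> V \<inter> U}"
    then have C: "compact C" "C \<subseteq> V" "C \<subseteq> U" by auto
    have "outer_content (U - V) \<le> inner_content (U - C)"
      using C compact_imp_closed[OF C(1)] U by (intro outer_content_le_inner open_Diff) auto
    then have "ennreal (m C) + outer_content (U - V) \<le> ennreal (m C) + inner_content (U - C)"
      by (rule add_left_mono)
    also have "\<dots> = (SUP D\<in>{D. compact D \<and> D \<subseteq> U - C}. ennreal (m C) + ennreal (m D))"
      unfolding inner_content_def by (intro ennreal_SUP_add_right) auto
    also have "\<dots> \<le> inner_content U"
    proof (rule SUP_least)
      fix D assume "D \<in> {D. compact D \<and> D \<subseteq> U - C}"
      then have D: "compact D" "D \<subseteq> U" "C \<inter> D = {}" by auto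
      have "ennreal (m C) + ennreal (m D) = ennreal (m (C \<union> D))"
        by (simp add: additive D nonneg)
      also have "\<dots> \<le> inner_content U" using C D by (intro inner_content_upper compact_Un) auto
      finally show "ennreal (m C) + ennreal (m D) \<le> inner_content U" .
    qed
    finally show "ennreal (m C) + outer_content (U - V) \<le> inner_content U" .
  qed
  finally show ?thesis .
qed

lemma open_in_lambda_system: "open V \<Longrightarrow> V \<in> lambda_system UNIV (Pow UNIV) outer_content"
proof -
  assume V: "open V"
  have "outer_content (V \<inter> A) + outer_content ((UNIV - V) \<inter> A) = outer_content A" for A
  proof (rule antisym)
    show "outer_content (V \<inter> A) + outer_content ((UNIV - V) \<inter> A) \<le> outer_content A"
    proof (rule outer_content_greatest)
      fix U assume U: "open U" "A \<subseteq> U"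
      have "outer_content (V \<inter> A) \<le> inner_content (V \<inter> U)"
        using U V by (intro outer_content_le_inner) auto
      moreover have "outer_content ((UNIV - V) \<inter> A) \<le> outer_content (U - V)"
        using U by (intro outer_content_mono) auto
      ultimately show "outer_content (V \<inter> A) + outer_content ((UNIV - V) \<inter> A) \<le> inner_content U"
        using inner_content_split[OF V U(1)] by (rule order_trans[OF add_mono])
    qed
  next
    note oms = outer_measure_space_outer_content[unfolded outer_measure_space_def]
    note ring_of_sets.countably_subadditive_subadditive[OF ring_of_sets_Pow oms[THEN conjunct1]
        oms[THEN conjunct2, THEN conjunct2]]
    then have "outer_content (V \<inter> A \<union> (UNIV - V) \<inter> A) \<le> outer_content (V \<inter> A) + outer_content ((UNIV - V) \<inter> A)"
      by (rule subadditiveD) auto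
    moreover have "V \<inter> A \<union> (UNIV - V) \<inter> A = A" by blast
    ultimately show "outer_content A \<le> outer_content (V \<inter> A) + outer_content ((UNIV - V) \<inter> A)" by simp
  qed
  then show ?thesis by (simp add: lambda_system_def)
qed

text \<open>
  The upper bound on open sets and the equality of total masses together squeeze the measure: it is
  below the content on open sets, hence above it on closed sets.  No mass is lost because the content
  lives on a compact set.
\<close>

lemma induced_measure:
  assumes K: "compact K" "m (- K) = 0"
  obtains M where "sets M = sets borel" "finite_measure M"
    "\<And>U. open U \<Longrightarrow> measure M U \<le> m U" "measure M UNIV = m UNIV"
proof -
  define M where "M = measure_of UNIV (sets borel) outer_content"
  let ?L = "lambda_system UNIV (Pow UNIV) outer_content"
  have L: "measure_space UNIV ?L outer_content"
    using sigma_algebra.caratheodory_lemma[OF sigma_algebra_Pow outer_measure_space_outer_content] .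
  then interpret L: sigma_algebra UNIV ?L by (simp add: measure_space_def)
  have "sets borel \<subseteq> ?L"
    unfolding sets_borel using open_in_lambda_system by (intro L.sigma_sets_subset) auto
  then have ms: "measure_space UNIV (sets borel) outer_content"
    using measure_down[OF L] sets.sigma_algebra_axioms[of borel] by simp
  have sets: "sets M = sets borel"
    unfolding M_def by (metis sets.sets_measure_of_eq space_borel)
  have em: "emeasure M A = outer_content A" if "A \<in> sets borel" for A
    unfolding M_def using ms that
    by (intro emeasure_measure_of_sigma) (auto simp: measure_space_def)
  have le: "emeasure M U \<le> ennreal (m U)" if "open U" for U
    using em[of U] that inner_content_le[of U] by (simp add: outer_content_open)
  have fin: "finite_measure M"
    using le[of UNIV] sets_eq_imp_space_eq[OF sets]
    by (intro finite_measureI) (auto simp: top_unique)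
  then interpret finite_measure M .
  show ?thesis
  proof
    show "sets M = sets borel" "finite_measure M" by fact+
    show meas: "measure M U \<le> m U" if "open U" for U
      using le[OF that] by (simp add: emeasure_eq_measure nonneg)
    have "m UNIV \<le> m K"
      using additive[of K "- K"] K(2) by simp
    then have "ennreal (m UNIV) \<le> emeasure M UNIV"
      using em[of UNIV] inner_content_upper[OF K(1), of UNIV] outer_content_open[of UNIV]
      by (simp add: order_trans[OF ennreal_leI])
    then have "m UNIV \<le> measure M UNIV"
      by (simp add: emeasure_eq_measure)
    with meas[of UNIV] show "measure M UNIV = m UNIV" by simp
  qed
qed

end

section \<open>Riesz representation on compact metric spaces\<close>

text \<open>
  Functions that are bounded on \<open>K\<close>, extended by zero.  Bounded functions without any regularity form a
  real vector space as the bounded continuous functions on the discrete copy of the underlying type;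
  allowing indicator functions of arbitrary sets is what makes a functional on this space induce a
  content.
\<close>

definition bfun :: "'e set \<Rightarrow> ('e \<Rightarrow> real) \<Rightarrow> ('e discrete \<Rightarrow>\<^sub>C real)" where
  "bfun K f = Bcontfun (\<lambda>x. indicator K (of_discrete x) * f (of_discrete x))"

lemma apply_bfun:
  assumes "bounded (f ` K)"
  shows "bfun K f x = indicator K (of_discrete x) * f (of_discrete x)"
proof -
  obtain B where B: "\<And>x. x \<in> K \<Longrightarrow> \<bar>f x\<bar> \<le> B" using assms by (auto simp: bounded_iff)
  have "norm (indicator K (of_discrete x) * f (of_discrete x)) \<le> max B 0" for x
    using B[of "of_discrete x"] by (auto simp: indicator_def)
  then have "bounded (range (\<lambda>x. indicator K (of_discrete x) * f (of_discrete x)))"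
    unfolding bounded_iff by blast
  moreover have "continuous_on UNIV (\<lambda>x. indicator K (of_discrete x) * f (of_discrete x))"
    by (simp add: continuous_on_open_vimage open_discrete)
  ultimately show ?thesis
    unfolding bfun_def by (subst Bcontfun_inverse) (auto simp: bcontfun_def)
qed

lemma apply_bfun_discrete: "bounded (f ` K) \<Longrightarrow> x \<in> K \<Longrightarrow> bfun K f (discrete x) = f x"
  by (simp add: apply_bfun discrete_inverse)

lemma bfun_cong: "(\<And>x. x \<in> K \<Longrightarrow> f x = g x) \<Longrightarrow> bfun K f = bfun K g"
  unfolding bfun_def by (intro arg_cong[where f=Bcontfun] ext) (auto simp: indicator_def)

lemma bfun_zero: "bfun K (\<lambda>x. 0) = 0"
proof (rule bcontfun_eqI)
  have "bounded ((\<lambda>x. 0::real) ` K)" by (auto simp: bounded_iff)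
  then show "apply_bcontfun (bfun K (\<lambda>x. 0)) x = apply_bcontfun 0 x" for x by (simp add: apply_bfun)
qed

lemma bfun_add:
  assumes "bounded (f ` K)" "bounded (g ` K)"
  shows "bfun K (\<lambda>x. f x + g x) = bfun K f + bfun K g"
proof -
  have "bounded ((\<lambda>x. f x + g x) ` K)" using assms by (rule bounded_plus_comp)
  then show ?thesis
    by (intro bcontfun_eqI) (simp add: apply_bfun assms plus_bcontfun.rep_eq algebra_simps)
qed

lemma bfun_scale:
  assumes "bounded (f ` K)"
  shows "bfun K (\<lambda>x. c * f x) = c *\<^sub>R bfun K f"
proof -
  have "bounded ((\<lambda>x. c * f x) ` K)" using bounded_scaleR_comp[OF assms, of c] by simp
  then show ?thesis
    by (intro bcontfun_eqI) (simp add: apply_bfun assms scaleR_bcontfun.rep_eq algebra_simps)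
qed

lemma bounded_image_const: "bounded ((\<lambda>x. c) ` K)"
  using bounded_subset[of "{c}" "(\<lambda>x. c) ` K"] by auto

lemma bounded_image_mult: "bounded (f ` K) \<Longrightarrow> bounded ((\<lambda>x. c * f x :: real) ` K)"
  using bounded_scaleR_comp[of f K c] by simp

lemma bounded_image_sum:
  fixes f :: "'i \<Rightarrow> 'e \<Rightarrow> real"
  assumes "\<And>i. i \<in> I \<Longrightarrow> bounded (f i ` K)"
  shows "bounded ((\<lambda>x. \<Sum>i\<in>I. f i x) ` K)"
  using assms
  by (induction I rule: infinite_finite_induct) (simp_all add: bounded_image_const bounded_plus_comp)

lemma bfun_sum:
  assumes "\<And>i. i \<in> I \<Longrightarrow> bounded (f i ` K)"
  shows "bfun K (\<lambda>x. \<Sum>i\<in>I. f i x) = (\<Sum>i\<in>I. bfun K (f i))"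
  using assms
proof (induction I rule: infinite_finite_induct)
  case (insert i I)
  have "bounded ((\<lambda>x. \<Sum>i\<in>I. f i x) ` K)"
    using insert.prems insert.hyps
    by (intro bounded_image_sum) auto
  with insert show ?case by (simp add: bfun_add)
qed (simp_all add: bfun_zero)

lemma bounded_indicator: "bounded ((indicator A :: 'e \<Rightarrow> real) ` K)"
  by (auto simp: bounded_iff indicator_def intro!: exI[of _ 1])

lemma space_radon_on: "\<mu> \<in> radon_on K \<Longrightarrow> space \<mu> = K"
  unfolding radon_on_def by (auto dest: sets_eq_imp_space_eq simp: space_restrict_space)

lemma measurable_radon_on:
  fixes f :: "'e::metric_space \<Rightarrow> real"
  assumes "\<mu> \<in> radon_on K" "continuous_on K f"
  shows "f \<in> borel_measurable \<mu>"
  using borel_measurable_continuous_on_restrict[OF assms(2)] assms(1)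
  by (simp add: radon_on_def cong: measurable_cong_sets)

lemma integrable_radon_on:
  fixes f :: "'e::metric_space \<Rightarrow> real"
  assumes \<mu>: "\<mu> \<in> radon_on K" and K: "compact K" and f: "continuous_on K f"
  shows "integrable \<mu> f"
proof -
  interpret finite_measure \<mu> using \<mu> by (simp add: radon_on_def)
  obtain B where "\<And>x. x \<in> K \<Longrightarrow> norm (f x) \<le> B"
    using compact_imp_bounded[OF compact_continuous_image[OF f K]] by (auto simp: bounded_iff)
  then show ?thesis
    using space_radon_on[OF \<mu>] measurable_radon_on[OF \<mu> f]
    by (intro integrable_const_bound[of _ B]) auto
qed

lemma bounded_continuous_image:
  fixes f :: "'e::metric_space \<Rightarrow> real"
  shows "compact K \<Longrightarrow> continuous_on K f \<Longrightarrow> bounded (f ` K)"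
  by (intro compact_imp_bounded compact_continuous_image)

text \<open>
  The sum counts the integers in \<open>[0, y)\<close>, of which there are \<open>\<lceil>y\<rceil>\<close>.  With \<open>y = n f x\<close> this sandwiches a
  function between sums of indicators of its superlevel sets, up to an error \<open>1/n\<close>.
\<close>

lemma layer_count:
  fixes y :: real
  assumes "0 \<le> y" "y \<le> real n"
  shows "y \<le> (\<Sum>k<n. if real k < y then 1 else 0)" "(\<Sum>k<n. if real k < y then 1 else 0) \<le> y + 1"
proof -
  have less: "real k < y \<longleftrightarrow> k < nat \<lceil>y\<rceil>" for k
    by (simp only: zless_nat_eq_int_zless less_ceiling_iff of_int_of_nat_eq)
  have "nat \<lceil>y\<rceil> \<le> n"
    using assms(2) by (simp only: nat_le_iff ceiling_le_iff of_int_of_nat_eq)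
  then have "{k \<in> {..<n}. real k < y} = {..<nat \<lceil>y\<rceil>}"
    unfolding less lessThan_def by (blast intro: less_le_trans)
  moreover have "(\<Sum>k<n. if real k < y then 1 else 0) = real (card {k \<in> {..<n}. real k < y})"
    by (subst sum.inter_filter[symmetric]) auto
  ultimately have "(\<Sum>k<n. if real k < y then 1 else 0) = real (nat \<lceil>y\<rceil>)" by simp
  then show "y \<le> (\<Sum>k<n. if real k < y then 1 else 0)" "(\<Sum>k<n. if real k < y then 1 else 0) \<le> y + 1"
    using assms(1) by linarith+
qed

text \<open>
  The functional defines a content \<open>m\<close> on indicator functions, and the content induces a measure that
  is at most \<open>m\<close> on relatively open sets.  Superlevel sets of a continuous function are relatively open, so
  summing over the layers of \<open>f\<close> gives \<open>\<integral> f \<le> \<Lambda> f\<close> for \<open>0 \<le> f \<le> 1\<close>; the same inequality for \<open>1 - f\<close>,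
  together with equality of the total masses, gives the converse.
\<close>

theorem Riesz_representation:
  fixes \<Lambda> :: "('e::metric_space discrete \<Rightarrow>\<^sub>C real) \<Rightarrow> real"
  assumes lin: "linear \<Lambda>" and pos: "\<And>g :: 'e discrete \<Rightarrow>\<^sub>C real. (\<And>x. x \<in> K \<Longrightarrow> 0 \<le> apply_bcontfun g (discrete x)) \<Longrightarrow> 0 \<le> \<Lambda> g"
    and K: "compact K"
  obtains \<mu> where "\<mu> \<in> radon_on K" "\<And>f. continuous_on K f \<Longrightarrow> (\<integral>x. f x \<partial>\<mu>) = \<Lambda> (bfun K f)"
proof -
  define m where "m A = \<Lambda> (bfun K (indicator A))" for A
  have functional_mono: "\<Lambda> (bfun K f) \<le> \<Lambda> (bfun K g)"
    if "bounded (f ` K)" "bounded (g ` K)" "\<And>x. x \<in> K \<Longrightarrow> f x \<le> g x" for f g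
    using pos[of "bfun K g - bfun K f"] that linear_diff[OF lin, of "bfun K g" "bfun K f"]
    by (simp add: apply_bfun_discrete minus_bcontfun.rep_eq)
  have m_cong: "m A = m B" if "A \<inter> K = B \<inter> K" for A B
    unfolding m_def using that by (intro arg_cong[where f=\<Lambda>] bfun_cong) (auto simp: indicator_def)
  interpret content m
  proof
    show "0 \<le> m A" for A
      unfolding m_def by (intro pos) (simp add: apply_bfun_discrete bounded_indicator)
    show "m (A \<union> B) = m A + m B" if "A \<inter> B = {}" for A B
    proof -
      have "bfun K (indicator (A \<union> B)) = bfun K (\<lambda>x. indicator A x + indicator B x)"
        using that by (intro bfun_cong) (auto simp: indicator_def)
      then show ?thesis by (simp add: m_def bfun_add bounded_indicator linear_add[OF lin])
    qed
  qed
  have mK: "m (- K) = 0" using m_cong[of "- K" "{}"] content_empty by simp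
  obtain M where M: "sets M = sets borel" "finite_measure M"
    "\<And>U. open U \<Longrightarrow> measure M U \<le> m U" "measure M UNIV = m UNIV"
    using induced_measure[OF K mK] by blast
  have KM: "K \<in> sets M" using K M(1) by (simp add: compact_imp_closed borel_closed)
  define \<mu> where "\<mu> = restrict_space M K"
  have \<mu>: "\<mu> \<in> radon_on K"
    using M(2) KM sets_restrict_space_cong[OF M(1), of K]
    by (simp add: \<mu>_def radon_on_def finite_measure_restrict_space)
  then interpret mu: finite_measure \<mu> by (simp add: radon_on_def)
  interpret M: finite_measure M by (fact M(2))
  have space_M: "space M = UNIV" using sets_eq_imp_space_eq[OF M(1)] by simp
  have "measure M (- K) = 0"
    using M(3)[of "- K"] mK K compact_imp_closed[OF K] by (simp add: antisym open_Compl)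
  then have MK: "measure M K = m K"
    using M.finite_measure_compl[OF KM] M(4) space_M m_cong[of UNIV K]
    by (simp add: Compl_eq_Diff_UNIV)
  have layer: "measure \<mu> {x\<in>K. a < f x} \<le> m {x\<in>K. a < f x}" "{x\<in>K. a < f x} \<in> sets \<mu>"
    if f: "continuous_on K f" for f :: "'e \<Rightarrow> real" and a
  proof -
    obtain U where U: "open U" "U \<inter> K = f -` {a<..} \<inter> K"
      using f open_greaterThan[of a] unfolding continuous_on_open_invariant by blast
    moreover have "f -` {a<..} \<inter> K = {x\<in>K. a < f x}" by auto
    ultimately have U: "open U" "{x\<in>K. a < f x} = U \<inter> K" by simp_all
    have "measure \<mu> (U \<inter> K) = measure M (U \<inter> K)"
      unfolding \<mu>_def using KM by (intro measure_restrict_space) (auto simp: space_M)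
    also have "\<dots> \<le> measure M U"
      using U(1) M(1) by (intro M.finite_measure_mono) auto
    also have "\<dots> \<le> m (U \<inter> K)"
      using M(3)[OF U(1)] m_cong[of U "U \<inter> K"] by simp
    finally show "measure \<mu> {x\<in>K. a < f x} \<le> m {x\<in>K. a < f x}" using U(2) by simp
    show "{x\<in>K. a < f x} \<in> sets \<mu>"
      using U M(1) KM unfolding \<mu>_def by (auto simp: sets_restrict_space)
  qed
  have upper: "(\<integral>x. f x \<partial>\<mu>) \<le> \<Lambda> (bfun K f)"
    if f: "continuous_on K f" and f01: "\<And>x. x \<in> K \<Longrightarrow> 0 \<le> f x \<and> f x \<le> 1" for f
  proof -
    note fb = bounded_continuous_image[OF K f]
    have "real n * ((\<integral>x. f x \<partial>\<mu>) - \<Lambda> (bfun K f)) \<le> m K" for n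
    proof -
      define A where "A k = {x\<in>K. real k < real n * f x}" for k
      have A: "measure \<mu> (A k) \<le> m (A k)" "A k \<in> sets \<mu>" for k
        unfolding A_def using layer[OF continuous_on_mult_left[OF f, of "real n"]] by auto
      have count: "real n * f x \<le> (\<Sum>k<n. indicator (A k) x)"
        "(\<Sum>k<n. indicator (A k) x) \<le> real n * f x + 1" if "x \<in> K" for x
      proof -
        have "indicator (A k) x = (if real k < real n * f x then 1 else 0 :: real)" for k
          using that by (simp add: A_def indicator_def)
        then show "real n * f x \<le> (\<Sum>k<n. indicator (A k) x)" "(\<Sum>k<n. indicator (A k) x) \<le> real n * f x + 1"
          using layer_count[of "real n * f x" n] f01[OF that] by (simp_all only: mult_left_le mult_nonneg_nonneg of_nat_0_le_iff)
      qed
      have int: "integrable \<mu> (indicator (A k) :: 'e \<Rightarrow> real)" for k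
        using A(2) by (intro integrable_real_indicator) (simp_all add: mu.emeasure_eq_measure)
      have "real n * (\<integral>x. f x \<partial>\<mu>) = (\<integral>x. real n * f x \<partial>\<mu>)" by simp
      also have "\<dots> \<le> (\<integral>x. (\<Sum>k<n. indicator (A k) x) \<partial>\<mu>)"
        using count(1) space_radon_on[OF \<mu>] integrable_radon_on[OF \<mu> K f] int
        by (intro integral_mono Bochner_Integration.integrable_sum) auto
      also have "\<dots> = (\<Sum>k<n. measure \<mu> (A k))"
        using A(2) int by (simp add: Bochner_Integration.integral_sum)
      also have "\<dots> \<le> (\<Sum>k<n. m (A k))" by (intro sum_mono A)
      also have "\<dots> = \<Lambda> (bfun K (\<lambda>x. \<Sum>k<n. indicator (A k) x))"
        by (simp add: bfun_sum bounded_indicator m_def linear_sum[OF lin])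
      also have "\<dots> \<le> \<Lambda> (bfun K (\<lambda>x. real n * f x + indicator K x))"
        using count(2) fb
        by (intro functional_mono bounded_image_sum bounded_indicator bounded_plus_comp bounded_image_mult) auto
      also have "\<dots> = real n * \<Lambda> (bfun K f) + m K"
        unfolding bfun_add[OF bounded_image_mult[OF fb] bounded_indicator] bfun_scale[OF fb]
        by (simp add: linear_add[OF lin] linear_scale[OF lin] m_def)
      finally show ?thesis by (simp add: algebra_simps)
    qed
    then have "(\<integral>x. f x \<partial>\<mu>) - \<Lambda> (bfun K f) \<le> 0"
      by (meson not_le reals_Archimedean3)
    then show ?thesis by simp
  qed
  have one: "continuous_on K (\<lambda>x. 1::real)" by simp
  have mass: "(\<integral>x. 1 \<partial>\<mu>) = \<Lambda> (bfun K (\<lambda>x. 1))"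
  proof -
    have "measure \<mu> K = m K" unfolding \<mu>_def MK[symmetric] using KM by (intro measure_restrict_space) (auto simp: space_M)
    moreover have "bfun K (indicator K) = bfun K (\<lambda>x. 1)" by (rule bfun_cong) simp
    ultimately show ?thesis using space_radon_on[OF \<mu>] by (simp add: m_def)
  qed
  have affine: "(\<integral>x. a * f x + b \<partial>\<mu>) - \<Lambda> (bfun K (\<lambda>x. a * f x + b)) = a * ((\<integral>x. f x \<partial>\<mu>) - \<Lambda> (bfun K f))"
    if f: "continuous_on K f" for f a b
  proof -
    note int = integrable_radon_on[OF \<mu> K f]
    note fb = bounded_continuous_image[OF K f]
    have fb': "bounded ((\<lambda>x. a * f x) ` K)" using bounded_scaleR_comp[OF fb, of a] by simp
    have b1: "bounded ((\<lambda>x. 1::real) ` K)" "bounded ((\<lambda>x. b) ` K)" by (auto simp: bounded_iff)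
    have "bfun K (\<lambda>x. b) = b *\<^sub>R bfun K (\<lambda>x. 1)" using bfun_scale[OF b1(1), of b] by simp
    then have "\<Lambda> (bfun K (\<lambda>x. a * f x + b)) = a * \<Lambda> (bfun K f) + b * \<Lambda> (bfun K (\<lambda>x. 1))"
      by (simp add: bfun_add[OF fb' b1(2)] bfun_scale fb linear_add[OF lin] linear_scale[OF lin])
    moreover have "(\<integral>x. a * f x + b \<partial>\<mu>) = a * (\<integral>x. f x \<partial>\<mu>) + b * (\<integral>x. 1 \<partial>\<mu>)"
      using int by (simp add: mult.commute)
    ultimately show ?thesis using mass by (simp add: algebra_simps)
  qed
  have unit: "(\<integral>x. f x \<partial>\<mu>) = \<Lambda> (bfun K f)"
    if f: "continuous_on K f" and f01: "\<And>x. x \<in> K \<Longrightarrow> 0 \<le> f x \<and> f x \<le> 1" for f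
    using upper[OF f f01] upper[of "\<lambda>x. - 1 * f x + 1"] affine[OF f, of "- 1" 1] f f01
    by (fastforce intro!: continuous_intros)
  show ?thesis
  proof
    show "\<mu> \<in> radon_on K" by (fact \<mu>)
    fix f :: "'e \<Rightarrow> real" assume f: "continuous_on K f"
    obtain B where B: "0 < B" "\<And>x. x \<in> K \<Longrightarrow> \<bar>f x\<bar> \<le> B"
      using bounded_continuous_image[OF K f] by (auto simp: bounded_pos)
    define g where "g = (\<lambda>x. 1 / (2 * B) * f x + 1 / 2)"
    have "0 \<le> g x \<and> g x \<le> 1" if "x \<in> K" for x
      using B(1) B(2)[OF that] by (auto simp: g_def field_simps abs_le_iff)
    moreover have "continuous_on K g" unfolding g_def by (intro continuous_intros f)
    ultimately have "(\<integral>x. g x \<partial>\<mu>) = \<Lambda> (bfun K g)" using unit by blast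
    then show "(\<integral>x. f x \<partial>\<mu>) = \<Lambda> (bfun K f)"
      using affine[OF f, of "1 / (2 * B)" "1 / 2"] B(1) by (simp add: g_def)
  qed
qed

section \<open>Measures that agree on continuous functions\<close>

lemma nn_integral_measure_combination:
  assumes sets: "sets N1 = sets N3" "sets N2 = sets N3"
    and eq: "\<And>A. A \<in> sets N3 \<Longrightarrow> a * emeasure N1 A + emeasure N2 A = emeasure N3 A"
    and u: "u \<in> borel_measurable N3"
  shows "a * nn_integral N1 u + nn_integral N2 u = nn_integral N3 u"
  using u
proof (induction rule: borel_measurable_induct)
  note [measurable_cong] = sets
  case (cong f g)
  then show ?case
    using sets_eq_imp_space_eq[OF sets(1)] sets_eq_imp_space_eq[OF sets(2)]
    by (simp cong: nn_integral_cong_simp)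
next
  case (set A)
  then show ?case using eq[OF set] sets by simp
next
  note [measurable_cong] = sets
  case (mult u c)
  note [measurable] = mult.hyps(2)
  show ?case
    using mult.IH by (simp add: nn_integral_cmult mult.left_commute[of a c] distrib_left[symmetric])
next
  note [measurable_cong] = sets
  case (add u v)
  note [measurable] = add.hyps(1) add.hyps(3)
  have "nn_integral N3 (\<lambda>x. v x + u x) = (a * nn_integral N1 v + nn_integral N2 v) + (a * nn_integral N1 u + nn_integral N2 u)"
    by (simp add: nn_integral_add add.IH)
  then show ?case by (simp add: nn_integral_add distrib_left ac_simps)
next
  note [measurable_cong] = sets
  case (seq U)
  note [measurable] = seq.hyps(1)
  have mono: "incseq (\<lambda>i. nn_integral N (U i))" for N
    using seq.hyps(3) by (auto simp: incseq_def le_fun_def intro!: nn_integral_mono)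
  have "(SUP i. U i) = (\<lambda>x. SUP i. U i x)" by (simp add: fun_eq_iff image_comp)
  then have sup: "nn_integral N (SUP i. U i) = (SUP i. nn_integral N (U i))"
    if "\<And>i. U i \<in> borel_measurable N" for N
    using nn_integral_monotone_convergence_SUP[OF seq.hyps(3) that] by simp
  have "a * nn_integral N1 (SUP i. U i) + nn_integral N2 (SUP i. U i)
      = a * (SUP i. nn_integral N1 (U i)) + (SUP i. nn_integral N2 (U i))"
    by (simp add: sup)
  also have "\<dots> = (SUP i. a * nn_integral N1 (U i)) + (SUP i. nn_integral N2 (U i))"
    by (simp add: SUP_mult_left_ennreal)
  also have "\<dots> = (SUP i. a * nn_integral N1 (U i) + nn_integral N2 (U i))"
    using mono by (intro ennreal_SUP_add[symmetric]) (auto simp: incseq_def intro: mult_left_mono)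
  also have "\<dots> = nn_integral N3 (SUP i. U i)"
    by (simp add: sup seq.IH)
  finally show ?case .
qed

lemma integral_measure_combination:
  fixes w :: "'e::metric_space \<Rightarrow> real"
  assumes K: "compact K" and N: "N1 \<in> radon_on K" "N2 \<in> radon_on K" "N3 \<in> radon_on K" and a: "0 \<le> a"
    and eq: "\<And>A. A \<in> sets (restrict_space borel K) \<Longrightarrow>
      ennreal a * emeasure N1 A + emeasure N2 A = emeasure N3 A"
    and w: "continuous_on K w" "\<And>x. x \<in> K \<Longrightarrow> 0 \<le> w x"
  shows "a * (\<integral>x. w x \<partial>N1) + (\<integral>x. w x \<partial>N2) = (\<integral>x. w x \<partial>N3)"
proof -
  have sets: "sets N1 = sets N3" "sets N2 = sets N3" "sets N3 = sets (restrict_space borel K)"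
    using N by (auto simp: radon_on_def)
  have nn: "(\<integral>\<^sup>+x. ennreal (w x) \<partial>N) = ennreal (\<integral>x. w x \<partial>N)" and ge: "0 \<le> (\<integral>x. w x \<partial>N)" if "N \<in> radon_on K" for N
    using integrable_radon_on[OF that K w(1)] space_radon_on[OF that] w(2)
    by (auto intro!: nn_integral_eq_integral integral_nonneg_AE)
  have "ennreal a * (\<integral>\<^sup>+x. ennreal (w x) \<partial>N1) + (\<integral>\<^sup>+x. ennreal (w x) \<partial>N2) = (\<integral>\<^sup>+x. ennreal (w x) \<partial>N3)"
    using eq sets measurable_radon_on[OF N(3) w(1)]
    by (intro nn_integral_measure_combination) auto
  then have "ennreal (a * (\<integral>x. w x \<partial>N1) + (\<integral>x. w x \<partial>N2)) = ennreal (\<integral>x. w x \<partial>N3)"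
    using nn[OF N(1)] nn[OF N(2)] nn[OF N(3)] ge[OF N(1)] ge[OF N(2)] a
    by (simp add: ennreal_mult ennreal_plus)
  then show ?thesis
    using ge[OF N(1)] ge[OF N(2)] ge[OF N(3)] a by (subst (asm) ennreal_inj) auto
qed

lemma integral_tendsto_measure_closed:
  fixes K :: "'e::metric_space set"
  assumes K: "compact K" and N: "N \<in> radon_on K" and A: "closed A" "A \<subseteq> K" "A \<noteq> {}"
  shows "(\<lambda>n. \<integral>x. max 0 (1 - real n * infdist x A) \<partial>N) \<longlonglongrightarrow> measure N A"
proof -
  interpret finite_measure N using N by (simp add: radon_on_def)
  have AN: "A \<in> sets N" 
    using N A compact_imp_closed[OF K] by (auto simp: radon_on_def sets_restrict_space_iff)
  have cont: "continuous_on K (\<lambda>x. max 0 (1 - real n * infdist x A))" for n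
    by (intro continuous_intros)
  have "(\<lambda>n. \<integral>x. max 0 (1 - real n * infdist x A) \<partial>N) \<longlonglongrightarrow> (\<integral>x. indicator A x \<partial>N)"
  proof (rule integral_dominated_convergence[where w="\<lambda>x. 1"])
    show "AE x in N. (\<lambda>n. max 0 (1 - real n * infdist x A)) \<longlonglongrightarrow> indicator A x"
    proof (rule AE_I2)
      fix x
      show "(\<lambda>n. max 0 (1 - real n * infdist x A)) \<longlonglongrightarrow> indicator A x"
      proof (cases "x \<in> A")
        case False
        then have "0 < infdist x A" using infdist_pos_not_in_closed[OF A(1,3)] by blast
        then obtain n0 where n0: "1 < real n0 * infdist x A" using reals_Archimedean3 by blast
        have "max 0 (1 - real n * infdist x A) = indicator A x" if "n \<ge> n0" for n
        proof -
          have "real n0 * infdist x A \<le> real n * infdist x A"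
            using that by (intro mult_right_mono infdist_nonneg) simp
          with n0 False show ?thesis by simp
        qed
        then show ?thesis by (intro tendsto_eventually eventually_sequentiallyI[of n0]) blast
      qed simp
    qed
    show "AE x in N. norm (max 0 (1 - real n * infdist x A)) \<le> 1" for n
      by (intro AE_I2) (simp add: infdist_nonneg)
  qed (use AN measurable_radon_on[OF N cont] in auto)
  then show ?thesis using AN by simp
qed

text \<open>
  The functions \<open>max 0 (1 - n dist(x, A))\<close> decrease to the indicator of a closed set \<open>A\<close>, so the
  identity of integrals passes to closed sets, which form an intersection-stable generator of the
  Borel sets.
\<close>

lemma measure_combination_eqI:
  fixes K :: "'e::metric_space set"
  assumes K: "compact K" and N: "N1 \<in> radon_on K" "N2 \<in> radon_on K" "N3 \<in> radon_on K" and a: "0 \<le> a"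
    and eq: "\<And>w. continuous_on K w \<Longrightarrow> (\<And>x. x \<in> K \<Longrightarrow> 0 \<le> w x) \<Longrightarrow>
      a * (\<integral>x. w x \<partial>N1) + (\<integral>x. w x \<partial>N2) = (\<integral>x. w x \<partial>N3)"
    and A: "A \<in> sets (restrict_space borel K)"
  shows "ennreal a * emeasure N1 A + emeasure N2 A = emeasure N3 A"
proof -
  interpret N1: finite_measure N1 using N by (simp add: radon_on_def)
  interpret N2: finite_measure N2 using N by (simp add: radon_on_def)
  interpret N3: finite_measure N3 using N by (simp add: radon_on_def)
  note space = space_radon_on[OF N(1)] space_radon_on[OF N(2)] space_radon_on[OF N(3)]
  let ?G = "(\<inter>) K ` {A. closed A}"
  have generated: "sets (restrict_space borel K) = sigma_sets K ?G"
    using sigma_sets_Int[of K UNIV "{A. closed A}"] compact_imp_closed[OF K]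
    by (simp add: sets_restrict_space borel_eq_closed sets_measure_of)
  have sets: "sets N1 = sigma_sets K ?G" "sets N2 = sigma_sets K ?G" "sets N3 = sigma_sets K ?G"
    using N generated by (auto simp: radon_on_def)
  have closed: "a * measure N1 B + measure N2 B = measure N3 B" if B: "closed B" "B \<subseteq> K" for B
  proof (cases "B = {}")
    case False
    let ?w = "\<lambda>n x. max 0 (1 - real n * infdist x B)"
    have "(\<lambda>n. a * (\<integral>x. ?w n x \<partial>N1) + (\<integral>x. ?w n x \<partial>N2)) \<longlonglongrightarrow> a * measure N1 B + measure N2 B"
      using integral_tendsto_measure_closed[OF K N(1) B False] integral_tendsto_measure_closed[OF K N(2) B False]
      by (intro tendsto_intros)
    moreover have "a * (\<integral>x. ?w n x \<partial>N1) + (\<integral>x. ?w n x \<partial>N2) = (\<integral>x. ?w n x \<partial>N3)" for n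
      by (intro eq continuous_intros) simp
    ultimately show ?thesis
      using integral_tendsto_measure_closed[OF K N(3) B False] LIMSEQ_unique by simp
  qed simp
  have "a * measure N1 A + measure N2 A = measure N3 A"
    using A unfolding generated
  proof (induction rule: sigma_sets_induct_disjoint[rotated 2, consumes 1, case_names basic empty compl union int pow])
    case (basic B)
    then show ?case using compact_imp_closed[OF K] by (auto intro!: closed)
  next
    case (compl B)
    have whole: "a * measure N1 K + measure N2 K = measure N3 K"
      using compact_imp_closed[OF K] by (intro closed) auto
    have diff: "measure N1 (K - B) = measure N1 K - measure N1 B"
        "measure N2 (K - B) = measure N2 K - measure N2 B"
        "measure N3 (K - B) = measure N3 K - measure N3 B"
      using compl N1.finite_measure_compl[of B] N2.finite_measure_compl[of B] N3.finite_measure_compl[of B]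
      by (simp_all add: sets space)
    have "a * measure N1 (K - B) + measure N2 (K - B)
        = (a * measure N1 K + measure N2 K) - (a * measure N1 B + measure N2 B)"
      unfolding diff by (simp add: algebra_simps)
    then show ?case unfolding whole compl(2) diff(3) .
  next
    case (union B)
    then have B: "range B \<subseteq> sets N1" "range B \<subseteq> sets N2" "range B \<subseteq> sets N3" by (auto simp: sets)
    have s: "(\<lambda>i. a * measure N1 (B i) + measure N2 (B i)) sums (a * measure N1 (\<Union>i. B i) + measure N2 (\<Union>i. B i))"
      using N1.finite_measure_UNION[OF B(1) union(1)] N2.finite_measure_UNION[OF B(2) union(1)]
      by (intro sums_add sums_mult)
    show ?case
      by (rule sums_unique2[OF s[unfolded union(3)] N3.finite_measure_UNION[OF B(3) union(1)]])
  next
    case int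
    show ?case
    proof (rule Int_stableI_image)
      fix B B' :: "'e set" assume "B \<in> {A. closed A}" "B' \<in> {A. closed A}"
      then show "\<exists>D\<in>{A. closed A}. K \<inter> B \<inter> (K \<inter> B') = K \<inter> D"
        by (intro bexI[of _ "B \<inter> B'"]) auto
    qed
  qed auto
  then have "ennreal (a * measure N1 A + measure N2 A) = ennreal (measure N3 A)" by simp
  then show ?thesis
    by (simp add: N1.emeasure_eq_measure N2.emeasure_eq_measure N3.emeasure_eq_measure a ennreal_mult ennreal_plus)
qed

section \<open>The law of the state function\<close>

lemma p_in_range:
  assumes "compact X" "continuous_on X p" "x \<in> X"
  shows "p x \<in> {p_min X p..p_max X p}"
proof -
  have "bounded (p ` X)" using assms by (intro compact_imp_bounded compact_continuous_image)
  then have "bdd_below (p ` X)" "bdd_above (p ` X)"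
    by (auto simp: bounded_imp_bdd_below bounded_imp_bdd_above)
  with assms(3) show ?thesis unfolding p_min_def p_max_def by (auto intro: cINF_lower cSUP_upper)
qed

lemma state_law:
  fixes X :: "'a::euclidean_space set"
  assumes h: "0 < h" and X: "compact X" and p: "continuous_on X p"
    and \<mu>: "\<mu> \<in> radon_on \<Omega>" and \<Omega>: "\<And>s t x. (s, t, x) \<in> \<Omega> \<Longrightarrow> x \<in> X"
  shows state_law_radon_on: "state_law h X p \<mu> \<in> radon_on {p_min X p..p_max X p}"
    and integral_state_law: "\<And>w. continuous_on {p_min X p..p_max X p} w \<Longrightarrow>
      (\<And>q. q \<in> {p_min X p..p_max X p} \<Longrightarrow> 0 \<le> w q) \<Longrightarrow>
      (\<integral>q. w q \<partial>state_law h X p \<mu>) = (\<integral>(s, t, x). w (p x) \<partial>\<mu>) / h"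
proof -
  let ?I = "{p_min X p..p_max X p}"
  let ?S = "scale_measure (ennreal (1 / h)) \<mu>"
  interpret \<mu>: finite_measure \<mu> using \<mu> by (simp add: radon_on_def)
  have space: "space \<mu> = \<Omega>" by (rule space_radon_on[OF \<mu>])
  have "(\<lambda>(s, t, x). x) \<in> measurable (restrict_space borel \<Omega>) (restrict_space borel X)"
    using \<Omega> by (intro measurable_restrict_space2 borel_measurable_continuous_on_restrict)
      (auto simp: split_beta space_restrict_space intro!: continuous_intros)
  then have proj: "(\<lambda>(s, t, x). x) \<in> measurable ?S (restrict_space borel X)"
    using \<mu> by (simp add: radon_on_def cong: measurable_cong_sets)
  have p_meas: "p \<in> measurable (restrict_space borel X) (restrict_space borel ?I)"
    using p p_in_range[OF X p]
    by (intro measurable_restrict_space2 borel_measurable_continuous_on_restrict)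
      (auto simp: space_restrict_space)
  have S: "finite_measure ?S"
    by (rule finite_measureI)
      (simp add: space_scale_measure ennreal_mult_eq_top_iff \<mu>.emeasure_finite)
  have p_meas': "p \<in> measurable (distr ?S (restrict_space borel X) (\<lambda>(s, t, x). x)) (restrict_space borel ?I)"
    using p_meas by simp
  have "finite_measure (state_law h X p \<mu>)"
    unfolding state_law_def
    by (intro finite_measure.finite_measure_distr S proj p_meas')
  then show "state_law h X p \<mu> \<in> radon_on ?I"
    by (simp add: radon_on_def state_law_def)
  fix w :: "real \<Rightarrow> real" assume w: "continuous_on ?I w" "\<And>q. q \<in> ?I \<Longrightarrow> 0 \<le> w q"
  have w_meas: "w \<in> borel_measurable (restrict_space borel ?I)"
    using w(1) by (rule borel_measurable_continuous_on_restrict)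
  let ?g = "\<lambda>(s, t, x). w (p x)"
  have g_nonneg: "0 \<le> ?g y" if "y \<in> \<Omega>" for y
    using that \<Omega> w(2) p_in_range[OF X p] by (auto split: prod.splits)
  have g_eq: "?g = (\<lambda>y. w (p (case y of (s, t, x) \<Rightarrow> x)))" by (auto simp: fun_eq_iff)
  have g_meas: "?g \<in> borel_measurable ?S"
    unfolding g_eq using measurable_compose[OF measurable_compose[OF proj p_meas] w_meas] .
  then have g_meas': "?g \<in> borel_measurable \<mu>" by (simp cong: measurable_cong_sets)
  have "(\<integral>q. w q \<partial>state_law h X p \<mu>) = (\<integral>y. ?g y \<partial>?S)"
    unfolding state_law_def
    using integral_distr[OF p_meas' w_meas] integral_distr[OF proj measurable_compose[OF p_meas w_meas]]
    by (simp add: split_beta)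
  also have "\<dots> = enn2real (\<integral>\<^sup>+y. ennreal (?g y) \<partial>?S)"
    using g_meas g_nonneg space by (intro integral_eq_nn_integral AE_I2) (auto simp: space_scale_measure)
  also have "\<dots> = enn2real (ennreal (1 / h) * (\<integral>\<^sup>+y. ennreal (?g y) \<partial>\<mu>))"
    using g_meas' by (subst nn_integral_scale_measure) auto
  also have "\<dots> = (\<integral>y. ?g y \<partial>\<mu>) / h"
    using g_meas' g_nonneg space h by (subst integral_eq_nn_integral) (auto simp: enn2real_mult intro!: AE_I2)
  finally show "(\<integral>q. w q \<partial>state_law h X p \<mu>) = (\<integral>(s, t, x). w (p x) \<partial>\<mu>) / h" .
qed

section \<open>Supports and test functions of the programs\<close>

type_synonym 'e bounded_fun = "'e discrete \<Rightarrow>\<^sub>C real"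

type_synonym 'a ES_tuple =
  "(real \<times> 'a) bounded_fun \<times> (real \<times> 'a) bounded_fun \<times> (real \<times> real \<times> 'a) bounded_fun
    \<times> (real \<times> real \<times> 'a) bounded_fun \<times> real bounded_fun \<times> real bounded_fun"

locale ES_setting =
  fixes T h \<epsilon> :: real and tm :: time_model
    and X X0 :: "'a::euclidean_space set" and p :: "'a \<Rightarrow> real"
    and C :: "(real \<times> 'a \<Rightarrow> real) set"
    and L :: "(real \<times> 'a \<Rightarrow> real) \<Rightarrow> (real \<times> 'a \<Rightarrow> real)"
  assumes h: "0 < h" "h \<le> T" and \<epsilon>: "0 \<le> \<epsilon>"
    and X: "compact X" and X0: "compact X0" "X0 \<subseteq> X" and p: "continuous_on X p"
    and generator: "is_generator T X C L"
    and one: "(\<lambda>_. 1) \<in> C" "\<And>z. z \<in> {0..T} \<times> X \<Longrightarrow> L (\<lambda>_. 1) z = 0"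
begin

abbreviation "full \<equiv> {h..T} \<times> {0..T} \<times> X"
abbreviation "K0 \<equiv> {h..T} \<times> X0"
abbreviation "K\<tau> \<equiv> {h..T} \<times> X"
abbreviation "Kp \<equiv> Omega_plus_X h T X"
abbreviation "Km \<equiv> Omega_minus_X tm h T X"
abbreviation "I \<equiv> {p_min X p..p_max X p}"
abbreviation "tests \<equiv> aug_domain h T X C L"
abbreviation "gen \<equiv> aug_gen L"

lemma supports_subset: "Kp \<subseteq> full" "Km \<subseteq> full"
  by (auto simp: Omega_plus_X_def Omega_minus_X_def)

lemma compact_supports: "compact K0" "compact K\<tau>" "compact Kp" "compact Km" "compact I"
proof -
  have full: "compact full" using X by (intro compact_Times) auto
  define r where "r = (case tm of Continuous_Time \<Rightarrow> 0 | Discrete_Time dt \<Rightarrow> dt)"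
  have "Kp = full \<inter> ({y. fst y - h \<le> fst (snd y)} \<inter> {y. fst (snd y) \<le> fst y})"
    by (auto simp: Omega_plus_X_def)
  moreover have "Km = full \<inter> {y. fst (snd y) \<le> fst y - h - r}"
    by (auto simp: Omega_minus_X_def r_def split: time_model.splits)
  moreover have "closed ({y::real \<times> real \<times> 'a. fst y - h \<le> fst (snd y)} \<inter> {y. fst (snd y) \<le> fst y})"
    "closed {y::real \<times> real \<times> 'a. fst (snd y) \<le> fst y - h - r}"
    by (intro closed_Int closed_Collect_le continuous_intros)+
  ultimately show "compact Kp" "compact Km" using full by (simp_all only: compact_Int_closed)
  show "compact K0" "compact K\<tau>" "compact I" using X X0 by (auto intro: compact_Times)
qed

lemma p_in_I: "x \<in> X \<Longrightarrow> p x \<in> I"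
  by (rule p_in_range[OF X p])

lemma tests_continuous:
  assumes v: "v \<in> tests"
  shows "continuous_on K0 (\<lambda>(s, x). v (s, 0, x))" "continuous_on K\<tau> (\<lambda>(s, x). v (s, s, x))"
    "continuous_on Kp (gen v)" "continuous_on Km (gen v)"
proof -
  have c: "continuous_on full v" "continuous_on full (gen v)" using v by (auto simp: aug_domain_def)
  show "continuous_on Kp (gen v)" "continuous_on Km (gen v)"
    using continuous_on_subset[OF c(2)] supports_subset by blast+
  show "continuous_on K0 (\<lambda>(s, x). v (s, 0, x))" "continuous_on K\<tau> (\<lambda>(s, x). v (s, s, x))"
    unfolding split_beta using h X0
    by (auto intro!: continuous_on_compose2[OF c(1)] continuous_intros)
qed

lemma w_continuous:
  assumes "continuous_on I w"
  shows "continuous_on Kp (\<lambda>(s, t, x). w (p x))"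
  unfolding split_beta using p_in_I supports_subset(1)
  by (auto intro!: continuous_on_compose2[OF assms] continuous_on_compose2[OF p] continuous_intros)

lemma tests_add:
  assumes u: "u \<in> tests" and v: "v \<in> tests"
  shows "(\<lambda>y. u y + v y) \<in> tests" and "y \<in> full \<Longrightarrow> gen (\<lambda>y. u y + v y) y = gen u y + gen v y"
proof -
  have slice: "(\<lambda>(t, x). u (s, t, x) + v (s, t, x)) = (\<lambda>z. (\<lambda>(t, x). u (s, t, x)) z + (\<lambda>(t, x). v (s, t, x)) z)" for s
    by auto
  have C: "(\<lambda>(t, x). u (s, t, x)) \<in> C" "(\<lambda>(t, x). v (s, t, x)) \<in> C" if "s \<in> {h..T}" for s
    using u v that by (auto simp: aug_domain_def)
  note add = generator[unfolded is_generator_def, THEN conjunct2, THEN conjunct1, rule_format]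
  show g: "gen (\<lambda>y. u y + v y) y = gen u y + gen v y" if "y \<in> full" for y
    using that add[OF C] by (auto simp: aug_gen_def slice)
  have "(\<lambda>(t, x). u (s, t, x) + v (s, t, x)) \<in> C" if "s \<in> {h..T}" for s
    using add[OF C[OF that]] slice[of s] by simp
  moreover have "continuous_on full (\<lambda>y. gen u y + gen v y)" "continuous_on full (\<lambda>y. u y + v y)"
    using u v by (auto simp: aug_domain_def intro: continuous_on_add)
  ultimately show "(\<lambda>y. u y + v y) \<in> tests"
    using g by (simp add: aug_domain_def cong: continuous_on_cong)
qed

lemma tests_scale:
  assumes v: "v \<in> tests"
  shows "(\<lambda>y. c * v y) \<in> tests" and "y \<in> full \<Longrightarrow> gen (\<lambda>y. c * v y) y = c * gen v y"
proof -
  have slice: "(\<lambda>(t, x). c * v (s, t, x)) = (\<lambda>z. c * (\<lambda>(t, x). v (s, t, x)) z)" for s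
    by auto
  have C: "(\<lambda>(t, x). v (s, t, x)) \<in> C" if "s \<in> {h..T}" for s
    using v that by (auto simp: aug_domain_def)
  note scale = generator[unfolded is_generator_def, THEN conjunct2, THEN conjunct2, THEN conjunct1, rule_format]
  show g: "gen (\<lambda>y. c * v y) y = c * gen v y" if "y \<in> full" for y
    using that scale[OF C] by (auto simp: aug_gen_def slice)
  have "(\<lambda>(t, x). c * v (s, t, x)) \<in> C" if "s \<in> {h..T}" for s
    using scale[OF C[OF that]] slice[of s] by simp
  moreover have "continuous_on full (\<lambda>y. c * gen v y)" "continuous_on full (\<lambda>y. c * v y)"
    using v by (auto simp: aug_domain_def intro: continuous_on_mult_left)
  ultimately show "(\<lambda>y. c * v y) \<in> tests"
    using g by (simp add: aug_domain_def cong: continuous_on_cong)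
qed

text \<open>
  Constants and the time coordinate are the test functions that control the masses of the measures:
  their generators vanish and equal \<open>1\<close>, respectively.
\<close>

lemma tests_one: "(\<lambda>y. 1) \<in> tests" "y \<in> full \<Longrightarrow> gen (\<lambda>y. 1) y = 0"
proof -
  have slice: "(\<lambda>(t::real, x::'a). 1::real) = (\<lambda>_. 1)" by auto
  show g: "gen (\<lambda>y. 1) y = 0" if "y \<in> full" for y
    using that one(2) by (auto simp: aug_gen_def slice)
  have "continuous_on full (gen (\<lambda>y. 1)) \<longleftrightarrow> continuous_on full (\<lambda>y. 0::real)"
    using g by (intro continuous_on_cong) auto
  then show "(\<lambda>y. 1) \<in> tests" using one(1) by (simp add: aug_domain_def slice)
qed

lemma tests_time: "(\<lambda>(s, t, x). t) \<in> tests" "y \<in> full \<Longrightarrow> gen (\<lambda>(s, t, x). t) y = 1"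
proof -
  have time: "(\<lambda>(t, x). t) \<in> C" "\<And>z. z \<in> {0..T} \<times> X \<Longrightarrow> L (\<lambda>(t, x). t) z = 1"
    using generator by (auto simp: is_generator_def)
  show g: "gen (\<lambda>(s, t, x). t) y = 1" if "y \<in> full" for y
    using that time(2) by (auto simp: aug_gen_def)
  have "continuous_on full (gen (\<lambda>(s, t, x). t)) \<longleftrightarrow> continuous_on full (\<lambda>y. 1::real)"
    using g by (intro continuous_on_cong) auto
  moreover have "continuous_on full (\<lambda>(s, t, x). t)"
    unfolding split_beta by (intro continuous_intros)
  ultimately show "(\<lambda>(s, t, x). t) \<in> tests" using time(1) by (simp add: aug_domain_def)
qed

lemma tests_zero: "(\<lambda>y. 0) \<in> tests" "y \<in> full \<Longrightarrow> gen (\<lambda>y. 0) y = 0"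
  using tests_scale(1)[OF tests_one(1), of 0] tests_scale(2)[OF tests_one(1), where c=0] by auto

section \<open>Weak duality\<close>

text \<open>
  The objective is bounded by \<open>\<epsilon> \<integral>w d\<nu> + \<beta>\<close>, the law constraint bounds \<open>\<epsilon> \<integral>w d\<nu>\<close> by the integral of
  \<open>w (p x) / h\<close> against \<open>\<mu>p\<close> because \<open>w \<ge> 0\<close>, the generator inequality on \<open>Kp\<close> trades that for \<open>h \<xi> - \<integral>Lv d\<mu>p\<close>, and the
  Liouville equation bounds the last integral from below by \<open>- \<gamma>\<close>.
\<close>

lemma weak_duality:
  assumes m: "ES_measure_feasible tm h T \<epsilon> X X0 p C L \<mu>0 \<mu>\<tau> \<mu>p \<mu>m \<nu> \<nu>'"
    and f: "ES_function_feasible tm h T \<epsilon> X X0 p C L v w \<gamma> \<xi> \<beta>"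
  shows "(\<integral>q. q \<partial>\<nu>) \<le> \<gamma> + h * \<xi> + \<beta>"
proof -
  have M: "\<mu>0 \<in> radon_on K0" "\<mu>\<tau> \<in> radon_on K\<tau>" "\<mu>p \<in> radon_on Kp" "\<mu>m \<in> radon_on Km"
    "\<nu> \<in> radon_on I" "\<nu>' \<in> radon_on I"
    and liouville: "(\<integral>(s, x). v (s, s, x) \<partial>\<mu>\<tau>) = (\<integral>(s, x). v (s, 0, x) \<partial>\<mu>0) + ((\<integral>y. gen v y \<partial>\<mu>m) + (\<integral>y. gen v y \<partial>\<mu>p))"
    and mass: "measure \<mu>0 (space \<mu>0) = 1" "measure \<mu>p (space \<mu>p) = h" "measure \<nu> (space \<nu>) = 1"
    and law: "\<And>A. A \<in> sets (restrict_space borel I) \<Longrightarrow>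
      ennreal \<epsilon> * emeasure \<nu> A + emeasure \<nu>' A = emeasure (state_law h X p \<mu>p) A"
    using m f by (auto simp: ES_measure_feasible_def ES_function_feasible_def)
  have v: "v \<in> tests" and w: "continuous_on I w" "\<And>q. q \<in> I \<Longrightarrow> 0 \<le> w q"
    and ineq: "\<And>s x. (s, x) \<in> K0 \<Longrightarrow> v (s, 0, x) \<le> \<gamma>" "\<And>s x. (s, x) \<in> K\<tau> \<Longrightarrow> 0 \<le> v (s, s, x)"
      "\<And>s t x. (s, t, x) \<in> Kp \<Longrightarrow> gen v (s, t, x) + w (p x) / h \<le> \<xi>"
      "\<And>y. y \<in> Km \<Longrightarrow> gen v y \<le> 0" "\<And>q. q \<in> I \<Longrightarrow> q \<le> \<epsilon> * w q + \<beta>"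
    using f by (auto simp: ES_function_feasible_def)
  note sp = M[THEN space_radon_on]
  interpret \<mu>0: finite_measure \<mu>0 using M by (simp add: radon_on_def)
  interpret \<mu>p: finite_measure \<mu>p using M by (simp add: radon_on_def)
  interpret \<nu>: finite_measure \<nu> using M by (simp add: radon_on_def)
  note int = integrable_radon_on[OF M(1) compact_supports(1) tests_continuous(1)[OF v]]
    integrable_radon_on[OF M(3) compact_supports(3) tests_continuous(3)[OF v]]
    integrable_radon_on[OF M(3) compact_supports(3) w_continuous[OF w(1)]]
    integrable_radon_on[OF M(5) compact_supports(5) w(1)]
    integrable_radon_on[OF M(5) compact_supports(5) continuous_on_id]
  have X_of: "\<And>s t x. (s, t, x) \<in> Kp \<Longrightarrow> x \<in> X" by (auto simp: Omega_plus_X_def)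
  have "\<epsilon> * (\<integral>q. w q \<partial>\<nu>) + (\<integral>q. w q \<partial>\<nu>') = (\<integral>(s, t, x). w (p x) \<partial>\<mu>p) / h"
    using integral_measure_combination[OF compact_supports(5) M(5,6)
        state_law_radon_on[OF h(1) X p M(3) X_of] \<epsilon> law w]
      integral_state_law[OF h(1) X p M(3) X_of w] by simp
  moreover have "0 \<le> (\<integral>q. w q \<partial>\<nu>')"
    using w(2) sp(6) by (intro integral_nonneg_AE AE_I2) auto
  ultimately have 1: "\<epsilon> * (\<integral>q. w q \<partial>\<nu>) \<le> (\<integral>(s, t, x). w (p x) \<partial>\<mu>p) / h" by linarith
  have "(\<integral>q. q \<partial>\<nu>) \<le> (\<integral>q. \<epsilon> * w q + \<beta> \<partial>\<nu>)"
    using int(4,5) ineq(5) sp(5) by (intro integral_mono) auto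
  also have "\<dots> = \<epsilon> * (\<integral>q. w q \<partial>\<nu>) + \<beta>"
    using int(4) mass(3) by simp
  finally have 2: "(\<integral>q. q \<partial>\<nu>) \<le> \<epsilon> * (\<integral>q. w q \<partial>\<nu>) + \<beta>" .
  have "(\<integral>y. gen v y + (\<lambda>(s, t, x). w (p x)) y / h \<partial>\<mu>p) \<le> (\<integral>y. \<xi> \<partial>\<mu>p)"
    using int(2,3) ineq(3) sp(3) by (intro integral_mono) auto
  then have 3: "(\<integral>y. gen v y \<partial>\<mu>p) + (\<integral>(s, t, x). w (p x) \<partial>\<mu>p) / h \<le> h * \<xi>"
    using int(2,3) mass(2) by simp
  have "0 \<le> (\<integral>(s, x). v (s, s, x) \<partial>\<mu>\<tau>)"
    using ineq(2) sp(2) by (intro integral_nonneg_AE AE_I2) auto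
  moreover have "(\<integral>(s, x). v (s, 0, x) \<partial>\<mu>0) \<le> (\<integral>y. \<gamma> \<partial>\<mu>0)"
    using ineq(1) sp(1) int(1) by (intro integral_mono) auto
  moreover have "0 \<le> (\<integral>y. - gen v y \<partial>\<mu>m)"
    using ineq(4) sp(4) by (intro integral_nonneg_AE AE_I2) auto
  ultimately have "0 \<le> \<gamma> + (\<integral>y. gen v y \<partial>\<mu>p)" using liouville mass(1) by simp
  with 1 2 3 show ?thesis by linarith
qed

section \<open>The measure program as a system of linear equations\<close>

text \<open>
  Pairing the six unknown measures with the components of \<open>row v w \<gamma> \<xi> \<beta>\<close> and adding up must give
  \<open>\<gamma> + h \<xi> + \<beta>\<close>; these equations, for all multipliers, are the constraints of the measure program.
  The components are the slacks of the function program, except for the term \<open>q\<close> of the objective in the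
  fifth.
\<close>

definition row :: "(real \<times> real \<times> 'a \<Rightarrow> real) \<Rightarrow> (real \<Rightarrow> real) \<Rightarrow> real \<Rightarrow> real \<Rightarrow> real \<Rightarrow> 'a ES_tuple" where
  "row v w \<gamma> \<xi> \<beta> =
    (bfun K0 (\<lambda>y. \<gamma> + - 1 * (\<lambda>(s, x). v (s, 0, x)) y), bfun K\<tau> (\<lambda>(s, x). v (s, s, x)),
     bfun Kp (\<lambda>y. \<xi> + - 1 * (gen v y + 1 / h * (\<lambda>(s, t, x). w (p x)) y)), bfun Km (\<lambda>y. - 1 * gen v y),
     bfun I (\<lambda>q. \<epsilon> * w q + \<beta>), bfun I w)"

definition rows :: "('a ES_tuple \<times> real) set" where
  "rows = {(row v w \<gamma> \<xi> \<beta>, \<gamma> + h * \<xi> + \<beta>) | v w \<gamma> \<xi> \<beta>. v \<in> tests \<and> continuous_on I w}"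

definition nonneg_tuples :: "'a ES_tuple set" where
  "nonneg_tuples = {(g0, g\<tau>, gp, gm, g1, g2).
    (\<forall>y\<in>K0. 0 \<le> apply_bcontfun g0 (discrete y)) \<and> (\<forall>y\<in>K\<tau>. 0 \<le> apply_bcontfun g\<tau> (discrete y)) \<and>
    (\<forall>y\<in>Kp. 0 \<le> apply_bcontfun gp (discrete y)) \<and> (\<forall>y\<in>Km. 0 \<le> apply_bcontfun gm (discrete y)) \<and>
    (\<forall>q\<in>I. 0 \<le> apply_bcontfun g1 (discrete q)) \<and> (\<forall>q\<in>I. 0 \<le> apply_bcontfun g2 (discrete q))}"

definition objective :: "'a ES_tuple" where
  "objective = (0, 0, 0, 0, bfun I (\<lambda>q. q), 0)"

lemma row_continuous:
  assumes v: "v \<in> tests" and w: "continuous_on I w"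
  shows "continuous_on K0 (\<lambda>y. \<gamma> + - 1 * (\<lambda>(s, x). v (s, 0, x)) y)"
    "continuous_on K\<tau> (\<lambda>(s, x). v (s, s, x))"
    "continuous_on Kp (\<lambda>y. \<xi> + - 1 * (gen v y + 1 / h * (\<lambda>(s, t, x). w (p x)) y))"
    "continuous_on Km (\<lambda>y. - 1 * gen v y)" "continuous_on I (\<lambda>q. \<epsilon> * w q + \<beta>)" "continuous_on I w"
  by (intro continuous_on_add continuous_on_mult_left continuous_on_const
      tests_continuous[OF v] w_continuous[OF w] w)+

lemma row_bounded:
  assumes "v \<in> tests" "continuous_on I w"
  shows "bounded ((\<lambda>y. \<gamma> + - 1 * (\<lambda>(s, x). v (s, 0, x)) y) ` K0)"
    "bounded ((\<lambda>(s, x). v (s, s, x)) ` K\<tau>)"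
    "bounded ((\<lambda>y. \<xi> + - 1 * (gen v y + 1 / h * (\<lambda>(s, t, x). w (p x)) y)) ` Kp)"
    "bounded ((\<lambda>y. - 1 * gen v y) ` Km)" "bounded ((\<lambda>q. \<epsilon> * w q + \<beta>) ` I)" "bounded (w ` I)"
  by (intro bounded_continuous_image compact_supports row_continuous[OF assms])+

lemma row_add:
  assumes v: "v \<in> tests" "v' \<in> tests" and w: "continuous_on I w" "continuous_on I w'"
  shows "row (\<lambda>y. v y + v' y) (\<lambda>q. w q + w' q) (\<gamma> + \<gamma>') (\<xi> + \<xi>') (\<beta> + \<beta>') = row v w \<gamma> \<xi> \<beta> + row v' w' \<gamma>' \<xi>' \<beta>'"
  unfolding row_def add_Pair bfun_add[OF row_bounded(1)[OF v(1) w(1)] row_bounded(1)[OF v(2) w(2)], symmetric]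
    bfun_add[OF row_bounded(2)[OF v(1) w(1)] row_bounded(2)[OF v(2) w(2)], symmetric]
    bfun_add[OF row_bounded(3)[OF v(1) w(1)] row_bounded(3)[OF v(2) w(2)], symmetric]
    bfun_add[OF row_bounded(4)[OF v(1) w(1)] row_bounded(4)[OF v(2) w(2)], symmetric]
    bfun_add[OF row_bounded(5)[OF v(1) w(1)] row_bounded(5)[OF v(2) w(2)], symmetric]
    bfun_add[OF row_bounded(6)[OF v(1) w(1)] row_bounded(6)[OF v(2) w(2)], symmetric]
  using tests_add(2)[OF v] supports_subset
  by (intro arg_cong2[where f=Pair] bfun_cong) (auto simp: algebra_simps add_divide_distrib subset_eq)

lemma row_scale:
  assumes v: "v \<in> tests" and w: "continuous_on I w"
  shows "row (\<lambda>y. c * v y) (\<lambda>q. c * w q) (c * \<gamma>) (c * \<xi>) (c * \<beta>) = c *\<^sub>R row v w \<gamma> \<xi> \<beta>"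
  unfolding row_def scaleR_Pair row_bounded[OF v w, THEN bfun_scale, symmetric]
  using tests_scale(2)[OF v] supports_subset
  by (intro arg_cong2[where f=Pair] bfun_cong) (auto simp: algebra_simps subset_eq)

lemma subspace_rows: "subspace rows"
proof (rule subspaceI)
  have "row (\<lambda>y. 0) (\<lambda>q. 0) 0 0 0 = 0"
    using row_scale[OF tests_zero(1), of "\<lambda>q. 0" 0 0 0 0] by simp
  then show "0 \<in> rows"
    unfolding rows_def using tests_zero(1)
    by (force intro!: exI[of _ "\<lambda>y. 0"] exI[of _ "\<lambda>q. 0"] exI[of _ 0] simp: zero_prod_def)
next
  fix a b assume "a \<in> rows" "b \<in> rows"
  then obtain v w \<gamma> \<xi> \<beta> v' w' \<gamma>' \<xi>' \<beta>' where
    *: "a = (row v w \<gamma> \<xi> \<beta>, \<gamma> + h * \<xi> + \<beta>)" "v \<in> tests" "continuous_on I w"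
      "b = (row v' w' \<gamma>' \<xi>' \<beta>', \<gamma>' + h * \<xi>' + \<beta>')" "v' \<in> tests" "continuous_on I w'"
    unfolding rows_def by blast
  have "a + b = (row (\<lambda>y. v y + v' y) (\<lambda>q. w q + w' q) (\<gamma> + \<gamma>') (\<xi> + \<xi>') (\<beta> + \<beta>'),
      (\<gamma> + \<gamma>') + h * (\<xi> + \<xi>') + (\<beta> + \<beta>'))"
    by (simp add: * row_add algebra_simps)
  then show "a + b \<in> rows"
    unfolding rows_def using tests_add(1)[OF *(2,5)] continuous_on_add[OF *(3,6)] by blast
next
  fix c a assume "a \<in> rows"
  then obtain v w \<gamma> \<xi> \<beta> where
    *: "a = (row v w \<gamma> \<xi> \<beta>, \<gamma> + h * \<xi> + \<beta>)" "v \<in> tests" "continuous_on I w"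
    unfolding rows_def by blast
  have "c *\<^sub>R a = (row (\<lambda>y. c * v y) (\<lambda>q. c * w q) (c * \<gamma>) (c * \<xi>) (c * \<beta>),
      c * \<gamma> + h * (c * \<xi>) + c * \<beta>)"
    unfolding *(1) row_scale[OF *(2,3)] by (simp add: algebra_simps)
  then show "c *\<^sub>R a \<in> rows"
    unfolding rows_def using tests_scale(1)[OF *(2)] continuous_on_mult_left[OF *(3)] by blast
qed

lemma row_majorizes_iff:
  assumes v: "v \<in> tests" and w: "continuous_on I w"
  shows "row v w \<gamma> \<xi> \<beta> - (g0, g\<tau>, gp, gm, g1, g2) \<in> nonneg_tuples \<longleftrightarrow>
    (\<forall>y\<in>K0. apply_bcontfun g0 (discrete y) \<le> \<gamma> + - 1 * (\<lambda>(s, x). v (s, 0, x)) y) \<and>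
    (\<forall>y\<in>K\<tau>. apply_bcontfun g\<tau> (discrete y) \<le> (\<lambda>(s, x). v (s, s, x)) y) \<and>
    (\<forall>y\<in>Kp. apply_bcontfun gp (discrete y) \<le> \<xi> + - 1 * (gen v y + 1 / h * (\<lambda>(s, t, x). w (p x)) y)) \<and>
    (\<forall>y\<in>Km. apply_bcontfun gm (discrete y) \<le> - 1 * gen v y) \<and>
    (\<forall>q\<in>I. apply_bcontfun g1 (discrete q) \<le> \<epsilon> * w q + \<beta>) \<and>
    (\<forall>q\<in>I. apply_bcontfun g2 (discrete q) \<le> w q)"
  unfolding row_def nonneg_tuples_def diff_Pair mem_Collect_eq prod.case minus_bcontfun.rep_eq
    diff_ge_0_iff_ge
  by (intro arg_cong2[where f=conj] ball_cong refl; simp only: row_bounded[OF v w, THEN apply_bfun_discrete])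

lemma row_majorizes_objective_iff:
  assumes v: "v \<in> tests" and w: "continuous_on I w"
  shows "row v w \<gamma> \<xi> \<beta> - objective \<in> nonneg_tuples \<longleftrightarrow> ES_function_feasible tm h T \<epsilon> X X0 p C L v w \<gamma> \<xi> \<beta>"
proof -
  have "bounded ((\<lambda>q. q) ` I)" using compact_supports(5) by (simp add: compact_imp_bounded)
  then have "apply_bcontfun (bfun I (\<lambda>q. q)) (discrete q) = q" if "q \<in> I" for q
    using that by (rule apply_bfun_discrete)
  then show ?thesis
    unfolding objective_def row_majorizes_iff[OF v w] ES_function_feasible_def
    using v w by (auto simp: algebra_simps)
qed

text \<open>
  An explicit row is at least a given constant \<open>B \<ge> 0\<close> in every component.  It comes from the test
  function \<open>B (T + 1 - t)\<close>: its generator is \<open>- B\<close>, which makes the components on \<open>Kp\<close> and \<open>Km\<close> large, and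
  it still has value at least \<open>B\<close> at \<open>t = s\<close>.  The multipliers \<open>\<beta> = B\<close> and \<open>w = B\<close> raise the last two
  components; the cost \<open>B / h\<close> of \<open>w\<close> on \<open>Kp\<close> is compensated by \<open>\<xi>\<close>, and \<open>\<gamma>\<close> compensates the value at
  \<open>t = 0\<close>.  On the measure side the existence of this row means that the masses of all six measures are
  bounded by the constraints.
\<close>

lemma rows_majorize: "\<exists>(f, b)\<in>rows. f - g \<in> nonneg_tuples"
proof -
  obtain g0 g\<tau> gp gm g1 g2 where g: "g = (g0, g\<tau>, gp, gm, g1, g2)" by (metis prod.exhaust)
  define B where "B = norm g0 + norm g\<tau> + norm gp + norm gm + norm g1 + norm g2"
  have B: "0 \<le> B" "norm g0 \<le> B" "norm g\<tau> \<le> B" "norm gp \<le> B" "norm gm \<le> B" "norm g1 \<le> B" "norm g2 \<le> B"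
    by (simp_all add: B_def)
  have le: "apply_bcontfun f x \<le> b" if "norm f \<le> B" "B \<le> b" for f :: "'e discrete \<Rightarrow>\<^sub>C real" and x b
    using norm_bounded[of f x] that by simp
  define v where "v = (\<lambda>y. (B * (T + 1)) * 1 + (- B) * (\<lambda>(s::real, t, x :: 'a). t) y)"
  note parts = tests_scale(1)[OF tests_one(1)] tests_scale(1)[OF tests_time(1)]
  have v: "v \<in> tests" unfolding v_def by (intro tests_add(1) parts)
  have gen_v: "gen v y = - B" if "y \<in> full" for y
    unfolding v_def tests_add(2)[OF parts that] tests_scale(2)[OF tests_one(1) that] tests_scale(2)[OF tests_time(1) that]
    using tests_one(2)[OF that] tests_time(2)[OF that] by simp
  let ?w = "\<lambda>q::real. B"
  have w: "continuous_on I ?w" by simp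
  have hB: "0 \<le> B / h" using B(1) h(1) by simp
  have "row v ?w (B * (T + 2)) (B * (1 + 1 / h)) B - g \<in> nonneg_tuples"
    unfolding g row_majorizes_iff[OF v w]
  proof (intro conjI ballI)
    fix y assume "y \<in> K0"
    show "apply_bcontfun g0 (discrete y) \<le> B * (T + 2) + - 1 * (\<lambda>(s, x). v (s, 0, x)) y"
      using B by (intro le) (auto simp: v_def algebra_simps split: prod.splits)
  next
    fix y assume "y \<in> K\<tau>"
    then show "apply_bcontfun g\<tau> (discrete y) \<le> (\<lambda>(s, x). v (s, s, x)) y"
      using B mult_left_mono[of "fst y" T B]
      by (intro le) (auto simp: v_def algebra_simps split: prod.splits)
  next
    fix y assume "y \<in> Kp"
    then show "apply_bcontfun gp (discrete y) \<le> B * (1 + 1 / h) + - 1 * (gen v y + 1 / h * (\<lambda>(s, t, x). B) y)"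
      using B gen_v[of y] supports_subset(1)
      by (intro le) (auto simp: algebra_simps split: prod.splits)
  next
    fix y assume "y \<in> Km"
    then show "apply_bcontfun gm (discrete y) \<le> - 1 * gen v y"
      using B gen_v[of y] supports_subset(2) by (intro le) auto
  next
    fix q
    show "apply_bcontfun g1 (discrete q) \<le> \<epsilon> * B + B" "apply_bcontfun g2 (discrete q) \<le> B"
      using B \<epsilon> by (intro le; simp)+
  qed
  then show ?thesis
    unfolding rows_def using v w by blast
qed

section \<open>Strong duality\<close>

text \<open>
  The functional produced by \<open>conic_duality\<close> splits into six positive functionals, one per component, and each of
  them is integration against a measure.  Expanding the equation of a general row into integrals gives
  \<open>balance\<close>; setting all multipliers but one to zero then recovers the constraints one at a time.
\<close>

lemma attaining_measures:
  assumes bound: "\<And>v w \<gamma> \<xi> \<beta>. ES_function_feasible tm h T \<epsilon> X X0 p C L v w \<gamma> \<xi> \<beta> \<Longrightarrow> d \<le> \<gamma> + h * \<xi> + \<beta>"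
  obtains \<mu>0 \<mu>\<tau> \<mu>p \<mu>m \<nu> \<nu>' where "ES_measure_feasible tm h T \<epsilon> X X0 p C L \<mu>0 \<mu>\<tau> \<mu>p \<mu>m \<nu> \<nu>'" "d \<le> (\<integral>q. q \<partial>\<nu>)"
proof -
  have "d \<le> b" if fb: "(f, b) \<in> rows" "f - objective \<in> nonneg_tuples" for f b
  proof -
    obtain v w \<gamma> \<xi> \<beta> where "f = row v w \<gamma> \<xi> \<beta>" "b = \<gamma> + h * \<xi> + \<beta>" "v \<in> tests" "continuous_on I w"
      using fb(1) unfolding rows_def by blast
    then show ?thesis using fb(2) bound row_majorizes_objective_iff by blast
  qed
  moreover have "0 \<in> nonneg_tuples" by (simp add: nonneg_tuples_def zero_prod_def)
  moreover have "f + g \<in> nonneg_tuples" if "f \<in> nonneg_tuples" "g \<in> nonneg_tuples" for f g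
    using that by (auto simp: nonneg_tuples_def plus_bcontfun.rep_eq)
  moreover have "c *\<^sub>R f \<in> nonneg_tuples" if "0 \<le> c" "f \<in> nonneg_tuples" for c f
    using that by (auto simp: nonneg_tuples_def scaleR_bcontfun.rep_eq)
  ultimately obtain \<Lambda> where \<Lambda>: "linear \<Lambda>" "\<And>f. f \<in> nonneg_tuples \<Longrightarrow> 0 \<le> \<Lambda> f"
    "\<And>f b. (f, b) \<in> rows \<Longrightarrow> \<Lambda> f = b" "d \<le> \<Lambda> objective"
    using conic_duality[OF subspace_rows, of nonneg_tuples objective d] rows_majorize by blast
  have linear_part: "linear (\<lambda>g. \<Lambda> (j g))" if "linear j" for j :: "'v::real_vector \<Rightarrow> 'a ES_tuple"
    using linear_compose[OF that \<Lambda>(1)] by (simp add: comp_def)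
  obtain \<mu>0 where \<mu>0: "\<mu>0 \<in> radon_on K0" "\<And>f. continuous_on K0 f \<Longrightarrow> (\<integral>y. f y \<partial>\<mu>0) = \<Lambda> (bfun K0 f, 0, 0, 0, 0, 0)"
    by (rule Riesz_representation[of "\<lambda>g. \<Lambda> (g, 0, 0, 0, 0, 0)" K0])
      (auto intro!: linear_part linearI \<Lambda>(2) simp: compact_supports nonneg_tuples_def)
  obtain \<mu>\<tau> where \<mu>\<tau>: "\<mu>\<tau> \<in> radon_on K\<tau>" "\<And>f. continuous_on K\<tau> f \<Longrightarrow> (\<integral>y. f y \<partial>\<mu>\<tau>) = \<Lambda> (0, bfun K\<tau> f, 0, 0, 0, 0)"
    by (rule Riesz_representation[of "\<lambda>g. \<Lambda> (0, g, 0, 0, 0, 0)" K\<tau>])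
      (auto intro!: linear_part linearI \<Lambda>(2) simp: compact_supports nonneg_tuples_def)
  obtain \<mu>p where \<mu>p: "\<mu>p \<in> radon_on Kp" "\<And>f. continuous_on Kp f \<Longrightarrow> (\<integral>y. f y \<partial>\<mu>p) = \<Lambda> (0, 0, bfun Kp f, 0, 0, 0)"
    by (rule Riesz_representation[of "\<lambda>g. \<Lambda> (0, 0, g, 0, 0, 0)" Kp])
      (auto intro!: linear_part linearI \<Lambda>(2) simp: compact_supports nonneg_tuples_def)
  obtain \<mu>m where \<mu>m: "\<mu>m \<in> radon_on Km" "\<And>f. continuous_on Km f \<Longrightarrow> (\<integral>y. f y \<partial>\<mu>m) = \<Lambda> (0, 0, 0, bfun Km f, 0, 0)"
    by (rule Riesz_representation[of "\<lambda>g. \<Lambda> (0, 0, 0, g, 0, 0)" Km])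
      (auto intro!: linear_part linearI \<Lambda>(2) simp: compact_supports nonneg_tuples_def)
  obtain \<nu> where \<nu>: "\<nu> \<in> radon_on I" "\<And>f. continuous_on I f \<Longrightarrow> (\<integral>y. f y \<partial>\<nu>) = \<Lambda> (0, 0, 0, 0, bfun I f, 0)"
    by (rule Riesz_representation[of "\<lambda>g. \<Lambda> (0, 0, 0, 0, g, 0)" I])
      (auto intro!: linear_part linearI \<Lambda>(2) simp: compact_supports nonneg_tuples_def)
  obtain \<nu>' where \<nu>': "\<nu>' \<in> radon_on I" "\<And>f. continuous_on I f \<Longrightarrow> (\<integral>y. f y \<partial>\<nu>') = \<Lambda> (0, 0, 0, 0, 0, bfun I f)"
    by (rule Riesz_representation[of "\<lambda>g. \<Lambda> (0, 0, 0, 0, 0, g)" I])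
      (auto intro!: linear_part linearI \<Lambda>(2) simp: compact_supports nonneg_tuples_def)
  interpret \<mu>0: finite_measure \<mu>0 using \<mu>0 by (simp add: radon_on_def)
  interpret \<mu>p: finite_measure \<mu>p using \<mu>p by (simp add: radon_on_def)
  interpret \<nu>: finite_measure \<nu> using \<nu> by (simp add: radon_on_def)
  have split: "\<Lambda> (a1, a2, a3, a4, a5, a6) = \<Lambda> (a1, 0, 0, 0, 0, 0) + \<Lambda> (0, a2, 0, 0, 0, 0)
      + \<Lambda> (0, 0, a3, 0, 0, 0) + \<Lambda> (0, 0, 0, a4, 0, 0) + \<Lambda> (0, 0, 0, 0, a5, 0) + \<Lambda> (0, 0, 0, 0, 0, a6)"
    for a1 a2 a3 a4 a5 a6
    by (simp add: linear_add[OF \<Lambda>(1), symmetric])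
  have balance: "(\<gamma> * measure \<mu>0 (space \<mu>0) - (\<integral>(s, x). v (s, 0, x) \<partial>\<mu>0)) + (\<integral>(s, x). v (s, s, x) \<partial>\<mu>\<tau>)
      + (\<xi> * measure \<mu>p (space \<mu>p) - (\<integral>y. gen v y \<partial>\<mu>p) - (\<integral>(s, t, x). w (p x) \<partial>\<mu>p) / h)
      - (\<integral>y. gen v y \<partial>\<mu>m) + (\<epsilon> * (\<integral>q. w q \<partial>\<nu>) + \<beta> * measure \<nu> (space \<nu>)) + (\<integral>q. w q \<partial>\<nu>')
      = \<gamma> + h * \<xi> + \<beta>"
    if v: "v \<in> tests" and w: "continuous_on I w" for v w \<gamma> \<xi> \<beta>
  proof -
    note c = row_continuous[OF v w]
    note int = integrable_radon_on[OF \<mu>0(1) compact_supports(1) tests_continuous(1)[OF v]]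
      integrable_radon_on[OF \<mu>p(1) compact_supports(3) tests_continuous(3)[OF v]]
      integrable_radon_on[OF \<mu>p(1) compact_supports(3) w_continuous[OF w]]
      integrable_radon_on[OF \<nu>(1) compact_supports(5) w]
    have "\<gamma> + h * \<xi> + \<beta> = \<Lambda> (row v w \<gamma> \<xi> \<beta>)"
      by (rule \<Lambda>(3)[symmetric]) (use v w in \<open>unfold rows_def, blast\<close>)
    also have "\<dots> = (\<integral>y. \<gamma> + - 1 * (\<lambda>(s, x). v (s, 0, x)) y \<partial>\<mu>0) + (\<integral>(s, x). v (s, s, x) \<partial>\<mu>\<tau>)
      + (\<integral>y. \<xi> + - 1 * (gen v y + 1 / h * (\<lambda>(s, t, x). w (p x)) y) \<partial>\<mu>p) + (\<integral>y. - 1 * gen v y \<partial>\<mu>m)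
      + (\<integral>q. \<epsilon> * w q + \<beta> \<partial>\<nu>) + (\<integral>q. w q \<partial>\<nu>')"
      unfolding row_def
      by (subst split) (simp only: \<mu>0(2)[OF c(1)] \<mu>\<tau>(2)[OF c(2)] \<mu>p(2)[OF c(3)] \<mu>m(2)[OF c(4)] \<nu>(2)[OF c(5)] \<nu>'(2)[OF c(6)])
    finally show ?thesis using int by (simp add: mult.commute)
  qed
  have gen0: "(\<integral>y. gen (\<lambda>y. 0) y \<partial>\<mu>p) = 0" "(\<integral>y. gen (\<lambda>y. 0) y \<partial>\<mu>m) = 0"
    using tests_zero(2) supports_subset space_radon_on[OF \<mu>p(1)] space_radon_on[OF \<mu>m(1)]
    by (auto intro!: integral_eq_zero_AE AE_I2)
  have w0: "continuous_on I (\<lambda>q. 0::real)" by simp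
  have mass: "measure \<mu>0 (space \<mu>0) = 1" "measure \<mu>p (space \<mu>p) = h" "measure \<nu> (space \<nu>) = 1"
    using balance[OF tests_zero(1) w0, of 1 0 0] balance[OF tests_zero(1) w0, of 0 1 0]
      balance[OF tests_zero(1) w0, of 0 0 1] gen0 by (simp_all add: case_prod_unfold)
  have liouville: "(\<integral>(s, x). v (s, s, x) \<partial>\<mu>\<tau>)
      = (\<integral>(s, x). v (s, 0, x) \<partial>\<mu>0) + ((\<integral>y. gen v y \<partial>\<mu>m) + (\<integral>y. gen v y \<partial>\<mu>p))" if "v \<in> tests" for v
    using balance[OF that w0, of 0 0 0] by (simp add: case_prod_unfold)
  have X_of: "\<And>s t x. (s, t, x) \<in> Kp \<Longrightarrow> x \<in> X" by (auto simp: Omega_plus_X_def)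
  have law: "ennreal \<epsilon> * emeasure \<nu> A + emeasure \<nu>' A = emeasure (state_law h X p \<mu>p) A"
    if A: "A \<in> sets (restrict_space borel I)" for A
  proof (rule measure_combination_eqI[OF compact_supports(5) \<nu>(1) \<nu>'(1) state_law_radon_on[OF h(1) X p \<mu>p(1) X_of] \<epsilon> _ A])
    fix w :: "real \<Rightarrow> real" assume w: "continuous_on I w" "\<And>q. q \<in> I \<Longrightarrow> 0 \<le> w q"
    show "\<epsilon> * (\<integral>q. w q \<partial>\<nu>) + (\<integral>q. w q \<partial>\<nu>') = (\<integral>q. w q \<partial>state_law h X p \<mu>p)"
      using balance[OF tests_zero(1) w(1), of 0 0 0] gen0 integral_state_law[OF h(1) X p \<mu>p(1) X_of w]
      by (simp add: case_prod_unfold)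
  qed
  show ?thesis
  proof
    show "ES_measure_feasible tm h T \<epsilon> X X0 p C L \<mu>0 \<mu>\<tau> \<mu>p \<mu>m \<nu> \<nu>'"
      unfolding ES_measure_feasible_def using \<mu>0(1) \<mu>\<tau>(1) \<mu>p(1) \<mu>m(1) \<nu>(1) \<nu>'(1) mass liouville law by blast
    show "d \<le> (\<integral>q. q \<partial>\<nu>)"
      using \<Lambda>(4) \<nu>(2)[OF continuous_on_id] by (simp add: objective_def)
  qed
qed

text \<open>
  The function program always has a feasible point, as some row majorizes the objective, so its value is
  either finite, and then attained by measures, or \<open>-\<infinity>\<close>, and then weak duality suffices.
\<close>

theorem strong_duality: "p_ES tm h T \<epsilon> X X0 p C L = d_ES tm h T \<epsilon> X X0 p C L"
proof (rule antisym)
  show "p_ES tm h T \<epsilon> X X0 p C L \<le> d_ES tm h T \<epsilon> X X0 p C L"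
    unfolding p_ES_def d_ES_def using weak_duality by (auto intro!: Sup_least Inf_greatest)
  obtain f b where fb: "(f, b) \<in> rows" "f - objective \<in> nonneg_tuples" using rows_majorize by blast
  then obtain v w \<gamma> \<xi> \<beta> where "ES_function_feasible tm h T \<epsilon> X X0 p C L v w \<gamma> \<xi> \<beta>"
    unfolding rows_def using row_majorizes_objective_iff by blast
  then have "d_ES tm h T \<epsilon> X X0 p C L \<le> ereal (\<gamma> + h * \<xi> + \<beta>)"
    unfolding d_ES_def by (intro Inf_lower) blast
  then consider "d_ES tm h T \<epsilon> X X0 p C L = -\<infinity>" | d where "d_ES tm h T \<epsilon> X X0 p C L = ereal d"
    by (cases "d_ES tm h T \<epsilon> X X0 p C L") auto
  then show "d_ES tm h T \<epsilon> X X0 p C L \<le> p_ES tm h T \<epsilon> X X0 p C L"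
  proof cases
    case 2
    have "d \<le> \<gamma> + h * \<xi> + \<beta>" if "ES_function_feasible tm h T \<epsilon> X X0 p C L v w \<gamma> \<xi> \<beta>" for v w \<gamma> \<xi> \<beta>
    proof -
      have "d_ES tm h T \<epsilon> X X0 p C L \<le> ereal (\<gamma> + h * \<xi> + \<beta>)"
        unfolding d_ES_def using that by (intro Inf_lower) blast
      with 2 show ?thesis by simp
    qed
    then obtain \<mu>0 \<mu>\<tau> \<mu>p \<mu>m \<nu> \<nu>' where
      m: "ES_measure_feasible tm h T \<epsilon> X X0 p C L \<mu>0 \<mu>\<tau> \<mu>p \<mu>m \<nu> \<nu>'" "d \<le> (\<integral>q. q \<partial>\<nu>)"
      using attaining_measures by blast
    have "ereal (\<integral>q. q \<partial>\<nu>) \<le> p_ES tm h T \<epsilon> X X0 p C L"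
      unfolding p_ES_def using m(1) by (intro Sup_upper) blast
    with m(2) 2 show ?thesis by (metis ereal_less_eq(3) order_trans)
  qed simp
qed

end

theorem theorem5p6:
  fixes T h \<epsilon> :: real
    and tm :: time_model
    and X X0 :: "'a::euclidean_space set"
    and p :: "'a \<Rightarrow> real"
    and C :: "(real \<times> 'a \<Rightarrow> real) set"
    and L :: "(real \<times> 'a \<Rightarrow> real) \<Rightarrow> (real \<times> 'a \<Rightarrow> real)"
  assumes "0 < T" and "0 < h" and "h \<le> T" and "0 \<le> \<epsilon>" and "\<epsilon> < 1"
    and "valid_time tm"
    and "X \<noteq> {}" and "X0 \<subseteq> X"
    and generator: "is_generator T X C L"
    and A1: "compact X0" "compact X" "compact {0..T}"
    and A2: "continuous_on X p"
    and A4: "\<And>v. v \<in> C \<Longrightarrow> continuous_on ({0..T} \<times> X) v"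
      "(\<lambda>_. 1) \<in> C" "\<And>z. z \<in> {0..T} \<times> X \<Longrightarrow> L (\<lambda>_. 1) z = 0"
    and A5: "\<And>u v. u \<in> C \<Longrightarrow> v \<in> C \<Longrightarrow> (\<lambda>z. u z * v z) \<in> C"
      "\<And>y z. y \<in> {0..T} \<times> X \<Longrightarrow> z \<in> {0..T} \<times> X \<Longrightarrow> y \<noteq> z \<Longrightarrow> \<exists>v \<in> C. v y \<noteq> v z"
    and A6: "\<exists>V. countable V \<and> V \<subseteq> C \<and>
      (\<forall>v \<in> C. (v, L v) \<in> bp_closure ({0..T} \<times> X) (graph_span L V))"
  shows "p_ES tm h T \<epsilon> X X0 p C L = d_ES tm h T \<epsilon> X X0 p C L"
proof -
  interpret ES_setting T h \<epsilon> tm X X0 p C L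
    using assms by unfold_locales auto
  show ?thesis by (rule strong_duality)
qed

end
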